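(* (a) Every cubic Blaschke product is conjugate by an element of $\mathcal{A}(\mathbb{D})$ to a Blaschke product of the form \[ B(z) = \mu \left( \frac{ z^3 - s_0^2 r_0 z^2 - s_0^2 z + r_0}{\overline{r_0} z^3 - s_0^2 z^2 - s_0^2 \overline{r_0} z + 1} \right), \] where $s_0 \in [0,1)$, $r_0 \in \mathbb{D}$, and $|\mu| = 1$. (b) Every cubic Blaschke product is conjugate by an element of $\mathcal{A}(\mathbb{D})$ to a Blaschke product of the form \[ B(z) = \frac{ z^3 - s r z^2 - \overline{s} z + r }{\overline{r} z^3 - s z^2 - \overline{s r}\, z + 1}, \] where $r, s \in \mathbb{D}$. This form is unique up to identifying $r$ with $-r$ (that is, up to identifying the parameter pair $(r,s)$ with $(-r,s)$).
   Context: $\mathbb{D}$ is the open unit disk in $\mathbb{C}$. A cubic Blaschke product is a finite Blaschke product of degree $3$, i.e. a map $B(z) = \mu \prod_{i=1}^3 \frac{z-w_i}{1-\overline{w_i} z}$ with $|\mu|=1$ and $w_1,w_2,w_3 \in \mathbb{D}$. $\mathcal{A}(\mathbb{D})$ is the set of Möbius automorphisms of $\mathbb{D}$, i.e. maps $A(z) = \mu \frac{z-w}{1-\overline{w}z}$ with $|\mu|=1$ and $w \in \mathbb{D}$. Two Blaschke products $B_1, B_2$ are conjugate by an element of $\mathcal{A}(\mathbb{D})$ if $B_2 = A \circ B_1 \circ A^{-1}$ for some $A \in \mathcal{A}(\mathbb{D})$. *)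

theory Defs
  imports "HOL-Complex_Analysis.Complex_Analysis"
begin

abbreviation unit_disk :: "complex set" ("\<bbbD>") where
  "\<bbbD> \<equiv> ball 0 1"

text \<open>
  Blaschke products are regarded as self-maps of the open unit disk: all equations between them
  are required on the disk only, where none of the denominators vanishes.  Since two rational maps
  that agree on the disk are equal, this is the same as equality of rational maps of the sphere,
  and it avoids the values that division by zero would give at the poles.
\<close>

definition blaschke_product :: "nat \<Rightarrow> (complex \<Rightarrow> complex) \<Rightarrow> bool" where
  "blaschke_product d B \<longleftrightarrow>
     (\<exists>\<mu> w. norm \<mu> = 1 \<and> (\<forall>i\<in>{1..d}. w i \<in> \<bbbD>) \<and>
        (\<forall>z\<in>\<bbbD>. B z = \<mu> * (\<Prod>i=1..d. (z - w i) / (1 - cnj (w i) * z))))"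

abbreviation cubic_blaschke_product :: "(complex \<Rightarrow> complex) \<Rightarrow> bool" where
  "cubic_blaschke_product \<equiv> blaschke_product 3"

definition disk_automorphisms :: "(complex \<Rightarrow> complex) set" where
  "disk_automorphisms =
     {A. \<exists>\<mu> w. norm \<mu> = 1 \<and> w \<in> \<bbbD> \<and> A = (\<lambda>z. \<mu> * ((z - w) / (1 - cnj w * z)))}"

definition disk_conjugate :: "(complex \<Rightarrow> complex) \<Rightarrow> (complex \<Rightarrow> complex) \<Rightarrow> bool" where
  "disk_conjugate B1 B2 \<longleftrightarrow>
     (\<exists>A\<in>disk_automorphisms. \<forall>z\<in>\<bbbD>. B2 z = (A \<circ> B1 \<circ> inv_into \<bbbD> A) z)"

definition form_a :: "complex \<Rightarrow> real \<Rightarrow> complex \<Rightarrow> complex \<Rightarrow> complex" where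
  "form_a \<mu> s0 r0 z =
     \<mu> * ((z^3 - of_real s0^2 * r0 * z^2 - of_real s0^2 * z + r0) /
          (cnj r0 * z^3 - of_real s0^2 * z^2 - of_real s0^2 * cnj r0 * z + 1))"

definition form_b :: "complex \<Rightarrow> complex \<Rightarrow> complex \<Rightarrow> complex" where
  "form_b r s z =
     (z^3 - s * r * z^2 - cnj s * z + r) / (cnj r * z^3 - s * z^2 - cnj (s * r) * z + 1)"

text \<open>The disk automorphisms are the library's Moebius functions, written with $\mu = e^{it}$.\<close>

lemma disk_automorphisms_eq_Moebius_function:
  "disk_automorphisms = {A. \<exists>t w. w \<in> \<bbbD> \<and> A = Moebius_function t w}"
proof -
  have "norm \<mu> = 1 \<longleftrightarrow> (\<exists>t. \<mu> = exp (\<i> * of_real t))" for \<mu> :: complex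
    by (metis norm_exp_i_times complex_norm_eq_1_exp)
  then show ?thesis
    unfolding disk_automorphisms_def Moebius_function_def fun_eq_iff by (auto; metis)
qed

end

theory Submission
  imports Defs
begin

text \<open>
  Both normal forms are \<open>A \<circ> f\<close> with a disk automorphism \<open>A\<close> and an odd Blaschke product
  \<open>f z = (z\<^sup>3 - cnj s z) / (1 - s z\<^sup>2)\<close>, called \<open>odd_cubic s\<close> below.  So the point is that
  every cubic Blaschke product \<open>B\<close> becomes odd after independent changes of coordinate in source and target
  (\<open>cubic_blaschke_equivalent_odd\<close>).  The reason is that \<open>B\<close> has two critical points in the disk; once their
  hyperbolic midpoint and its value are moved to \<open>0\<close>, the map is odd.  To make this explicit, one critical point is
  found (\<open>cubic_blaschke_critical_point\<close>: the numerator of the derivative is self-reciprocal and has no zero on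
  the circle) and is moved with its value to \<open>0\<close>, which leaves the maps
  \<open>z\<^sup>2 (z + p) / (1 + p z)\<close> with \<open>0 \<le> p < 1\<close>.  For these the midpoint is real and comes from the
  intermediate value theorem (\<open>balanced_base_point\<close>).

  If \<open>B \<circ> A = C \<circ> f\<close>, conjugating by the inverse of \<open>A\<close> turns \<open>B\<close> into an automorphism
  \<open>\<nu> * blaschke_factor w\<close> after \<open>f\<close>.  The remaining freedom is conjugation by a rotation, which multiplies both
  \<open>\<nu>\<close> and \<open>s\<close> by an arbitrary \<open>\<kappa>\<^sup>2\<close> of modulus \<open>1\<close>
  (\<open>cubic_blaschke_conjugate_family\<close>).  Form (a) makes \<open>s = s0\<^sup>2\<close> nonnegative, and form (b) makes
  \<open>\<nu> = 1\<close>.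

  For uniqueness, the critical points of \<open>odd_cubic s\<close> in the disk are a pair \<open>\<plusminus> c\<close>.  A conjugacy between two
  maps of form (b) preserves such pairs, hence their midpoint \<open>0\<close>, so it is a rotation by some \<open>\<kappa>\<close>
  (\<open>odd_cubic_equivalence_fixes_0\<close>).  Comparing coefficients gives \<open>s' = s\<close>, \<open>\<kappa>\<^sup>2 = 1\<close> and
  \<open>r' = \<kappa> r\<close> (\<open>form_b_conjugate_unique\<close>).
\<close>

section \<open>The group of disk automorphisms\<close>

definition blaschke_factor :: "complex \<Rightarrow> complex \<Rightarrow> complex" where
  "blaschke_factor w z = (z - w) / (1 - cnj w * z)"

lemma one_minus_cnj_mult_nonzero:
  assumes "norm w < 1" "norm z \<le> 1"
  shows "1 - cnj w * z \<noteq> 0"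
proof
  assume "1 - cnj w * z = 0"
  then have "norm w * norm z = 1"
    by (metis complex_mod_cnj norm_mult norm_one right_minus_eq)
  moreover have "norm w * norm z \<le> norm w * 1"
    using assms by (intro mult_left_mono) auto
  ultimately show False using assms by simp
qed

text \<open>
  Controls on which side of the unit circle a Blaschke factor has modulus below or above \<open>1\<close>.
\<close>

lemma norm_blaschke_identity:
  "(norm (1 - cnj w * z))\<^sup>2 - (norm (z - w))\<^sup>2 = (1 - (norm w)\<^sup>2) * (1 - (norm z)\<^sup>2)"
proof -
  have "complex_of_real ((norm (1 - cnj w * z))\<^sup>2 - (norm (z - w))\<^sup>2) =
      complex_of_real ((1 - (norm w)\<^sup>2) * (1 - (norm z)\<^sup>2))"
    unfolding of_real_diff of_real_mult complex_norm_square by (simp add: algebra_simps complex_norm_square del: of_real_power)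
  then show ?thesis by (simp only: of_real_eq_iff)
qed

lemma disk_automorphisms_iff:
  "A \<in> disk_automorphisms \<longleftrightarrow>
    (\<exists>\<mu> w. norm \<mu> = 1 \<and> norm w < 1 \<and> A = (\<lambda>z. \<mu> * blaschke_factor w z))"
  by (simp add: disk_automorphisms_def blaschke_factor_def dist_norm)

text \<open>
  The normal form \<open>(a z + b) / (cnj b z + cnj a)\<close> makes composition and inversion a matter of
  multiplying and inverting matrices in \<open>SU(1,1)\<close>, up to scaling; here \<open>a\<close> is a square root of the
  rotation factor.
\<close>

lemma disk_automorphism_fractional:
  assumes "A \<in> disk_automorphisms"
  obtains a b where "norm b < norm a" "\<And>z. norm z < 1 \<Longrightarrow> A z = (a * z + b) / (cnj b * z + cnj a)"
proof -
  obtain \<mu> w where A: "norm \<mu> = 1" "norm w < 1" "A = (\<lambda>z. \<mu> * blaschke_factor w z)"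
    using assms by (auto simp: disk_automorphisms_iff)
  define \<nu> where "\<nu> = csqrt \<mu>"
  have \<nu>: "\<nu> * \<nu> = \<mu>" by (metis \<nu>_def power2_csqrt power2_eq_square)
  then have n: "norm \<nu> = 1" using A(1) by (metis \<nu>_def norm_csqrt real_sqrt_one)
  then have c: "\<nu> * cnj \<nu> = 1" by (metis complex_norm_square of_real_1 one_power2)
  have nz: "\<nu> \<noteq> 0" using n by auto
  show ?thesis
  proof
    show "norm (- (\<nu> * w)) < norm \<nu>" using n A by (simp add: norm_mult)
    fix z :: complex assume z: "norm z < 1"
    have d: "1 - cnj w * z \<noteq> 0" using one_minus_cnj_mult_nonzero A z by auto
    have "cnj (- (\<nu> * w)) * z + cnj \<nu> = cnj \<nu> * (1 - cnj w * z)" by (simp add: algebra_simps)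
    moreover have "\<nu> * z + - (\<nu> * w) = \<nu> * (z - w)" by (simp add: algebra_simps)
    ultimately show "A z = (\<nu> * z + - (\<nu> * w)) / (cnj (- (\<nu> * w)) * z + cnj \<nu>)"
      using d nz c \<nu>[symmetric] by (simp add: A(3) blaschke_factor_def frac_eq_eq)
  qed
qed

lemma fractional_disk_automorphism:
  assumes "norm b < norm a"
  obtains A where "A \<in> disk_automorphisms" "\<And>z. norm z < 1 \<Longrightarrow> A z = (a * z + b) / (cnj b * z + cnj a)"
proof
  have a: "a \<noteq> 0" using assms by auto
  have w: "norm (- b / a) < 1" using assms a by (simp add: norm_divide)
  show "(\<lambda>z. (a / cnj a) * blaschke_factor (- b / a) z) \<in> disk_automorphisms"
    unfolding disk_automorphisms_iff using w a
    by (intro exI[of _ "a / cnj a"] exI[of _ "- b / a"]) (simp add: norm_divide)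
  fix z :: complex assume z: "norm z < 1"
  have "1 - cnj (- b / a) * z \<noteq> 0" using one_minus_cnj_mult_nonzero[OF w, of z] z by simp
  moreover have "cnj b * z + cnj a = cnj a * (1 - cnj (- b / a) * z)" using a by (simp add: field_simps)
  moreover have "a * z + b = a * (z - - b / a)" using a by (simp add: field_simps)
  ultimately show "(a / cnj a) * blaschke_factor (- b / a) z = (a * z + b) / (cnj b * z + cnj a)"
    using a by (simp add: blaschke_factor_def)
qed

lemma disk_automorphism_norm_less_1:
  assumes "A \<in> disk_automorphisms" "norm z < 1"
  shows "norm (A z) < 1"
proof -
  obtain \<mu> w where A: "norm \<mu> = 1" "norm w < 1" "A = (\<lambda>z. \<mu> * blaschke_factor w z)"
    using assms by (auto simp: disk_automorphisms_iff)
  have "norm (1 - cnj w * z)^2 - norm (z - w)^2 > 0"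
    unfolding norm_blaschke_identity using A assms by (simp add: power_less_one_iff)
  then have "norm (z - w) < norm (1 - cnj w * z)" by (simp add: power_less_imp_less_base)
  moreover from this have "norm (1 - cnj w * z) > 0" using norm_ge_zero[of "z - w"] by linarith
  ultimately show ?thesis using A by (simp add: blaschke_factor_def norm_mult norm_divide)
qed

lemma fractional_denominator_nonzero:
  fixes a b z :: complex
  assumes "norm b < norm a" "norm z < 1"
  shows "cnj b * z + cnj a \<noteq> 0"
proof
  assume "cnj b * z + cnj a = 0"
  then have "norm (cnj a) = norm (cnj b * z)" by (metis add.commute minus_unique norm_minus_cancel)
  also have "\<dots> \<le> norm b" using assms by (simp add: norm_mult mult_left_le)
  finally show False using assms by simp
qed

text \<open>
  Multiplicativity of the determinant \<open>|a|\<^sup>2 - |b|\<^sup>2\<close>; its positivity is what keeps a composition of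
  disk automorphisms a disk automorphism.
\<close>

lemma norm_fractional_composition:
  "(norm (a * c + b * cnj d))\<^sup>2 - (norm (a * d + b * cnj c))\<^sup>2 =
    ((norm a)\<^sup>2 - (norm b)\<^sup>2) * ((norm c)\<^sup>2 - (norm d)\<^sup>2)"
proof -
  have "complex_of_real ((norm (a * c + b * cnj d))\<^sup>2 - (norm (a * d + b * cnj c))\<^sup>2) =
      complex_of_real (((norm a)\<^sup>2 - (norm b)\<^sup>2) * ((norm c)\<^sup>2 - (norm d)\<^sup>2))"
    unfolding of_real_diff of_real_mult complex_norm_square by (simp add: algebra_simps complex_norm_square del: of_real_power)
  then show ?thesis by (simp only: of_real_eq_iff)
qed

lemma disk_automorphism_compose:
  assumes "A \<in> disk_automorphisms" "A' \<in> disk_automorphisms"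
  obtains C where "C \<in> disk_automorphisms" "\<And>z. norm z < 1 \<Longrightarrow> C z = A (A' z)"
proof -
  obtain a b where A: "norm b < norm a" "\<And>z. norm z < 1 \<Longrightarrow> A z = (a * z + b) / (cnj b * z + cnj a)"
    using disk_automorphism_fractional assms by metis
  obtain c d where A': "norm d < norm c" "\<And>z. norm z < 1 \<Longrightarrow> A' z = (c * z + d) / (cnj d * z + cnj c)"
    using disk_automorphism_fractional assms by metis
  have "norm (a * c + b * cnj d)^2 - norm (a * d + b * cnj c)^2 > 0"
    unfolding norm_fractional_composition using A(1) A'(1) by (simp add: power_strict_mono)
  then have "norm (a * d + b * cnj c) < norm (a * c + b * cnj d)" by (simp add: power_less_imp_less_base)
  then obtain C where C: "C \<in> disk_automorphisms" 
    "\<And>z. norm z < 1 \<Longrightarrow> C z = ((a * c + b * cnj d) * z + (a * d + b * cnj c)) /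
       (cnj (a * d + b * cnj c) * z + cnj (a * c + b * cnj d))"
    using fractional_disk_automorphism by metis
  show ?thesis
  proof (rule that[OF C(1)])
    fix z :: complex assume z: "norm z < 1"
    have nz: "cnj d * z + cnj c \<noteq> 0" using fractional_denominator_nonzero A'(1) z by blast
    have "A (A' z) = (a * A' z + b) / (cnj b * A' z + cnj a)"
      using A(2) disk_automorphism_norm_less_1 assms(2) z by blast
    also have "\<dots> = ((a * A' z + b) * (cnj d * z + cnj c)) / ((cnj b * A' z + cnj a) * (cnj d * z + cnj c))"
      using nz by simp
    also have "\<dots> = C z" using nz unfolding C(2)[OF z] A'(2)[OF z]
      by (simp add: distrib_right times_divide_eq_right) (simp add: algebra_simps)
    finally show "C z = A (A' z)" ..
  qed
qed

lemma fractional_inverse: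
  fixes a b z :: complex
  assumes "norm b < norm a" "norm z < 1"
  shows "(cnj a * ((a * z + b) / (cnj b * z + cnj a)) - b) / (a - cnj b * ((a * z + b) / (cnj b * z + cnj a))) = z"
proof -
  define d where "d = cnj b * z + cnj a"
  have d: "d \<noteq> 0" using fractional_denominator_nonzero[OF assms] by (simp add: d_def)
  define k where "k = a * cnj a - b * cnj b"
  have "k = of_real ((norm a)\<^sup>2 - (norm b)\<^sup>2)" by (simp add: k_def complex_norm_square del: of_real_power)
  moreover have "(norm a)\<^sup>2 - (norm b)\<^sup>2 > 0" using assms by (simp add: power_strict_mono)
  ultimately have k: "k \<noteq> 0" by (metis less_irrefl of_real_eq_0_iff)
  have "cnj a * ((a * z + b) / d) - b = (cnj a * (a * z + b) - b * d) / d" using d by (simp add: diff_divide_distrib)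
  also have "cnj a * (a * z + b) - b * d = k * z" by (simp add: d_def k_def algebra_simps)
  finally have 1: "cnj a * ((a * z + b) / d) - b = k * z / d" .
  have "a - cnj b * ((a * z + b) / d) = (a * d - cnj b * (a * z + b)) / d" using d by (simp add: diff_divide_distrib)
  also have "a * d - cnj b * (a * z + b) = k" by (simp add: d_def k_def algebra_simps)
  finally have 2: "a - cnj b * ((a * z + b) / d) = k / d" .
  show ?thesis unfolding d_def[symmetric] 1 2 using d k by simp
qed

lemma disk_automorphism_inverse:
  assumes "A \<in> disk_automorphisms"
  obtains C where "C \<in> disk_automorphisms" "\<And>z. norm z < 1 \<Longrightarrow> A (C z) = z" "\<And>z. norm z < 1 \<Longrightarrow> C (A z) = z"
proof -
  obtain a b where A: "norm b < norm a" "\<And>z. norm z < 1 \<Longrightarrow> A z = (a * z + b) / (cnj b * z + cnj a)"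
    using disk_automorphism_fractional assms by metis
  then obtain C where C: "C \<in> disk_automorphisms" 
    "\<And>z. norm z < 1 \<Longrightarrow> C z = (cnj a * z + (- b)) / (cnj (- b) * z + cnj (cnj a))"
    using fractional_disk_automorphism[of "- b" "cnj a"] by auto
  show ?thesis
  proof (rule that[OF C(1)])
    fix z :: complex assume z: "norm z < 1"
    note Az = disk_automorphism_norm_less_1[OF assms z] and Cz = disk_automorphism_norm_less_1[OF C(1) z]
    have "C (A z) = (cnj a * A z - b) / (a - cnj b * A z)" using C(2)[OF Az] by simp
    then show "C (A z) = z" using fractional_inverse[OF A(1) z] by (simp only: A(2)[OF z])
    have "A (C z) = (a * C z - (- b)) / (cnj a - cnj (- b) * C z)" using A(2)[OF Cz] by (simp add: add.commute)
    then show "A (C z) = z" 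
      using fractional_inverse[of "- b" "cnj a" z] A(1) z by (simp only: C(2)[OF z]) simp
  qed
qed

lemma rotation_disk_automorphism: "norm \<mu> = 1 \<Longrightarrow> (\<lambda>z. \<mu> * z) \<in> disk_automorphisms"
  unfolding disk_automorphisms_iff blaschke_factor_def
  by (rule exI[of _ \<mu>], rule exI[of _ 0]) simp

lemma blaschke_factor_disk_automorphism: "norm w < 1 \<Longrightarrow> blaschke_factor w \<in> disk_automorphisms"
  unfolding disk_automorphisms_iff by (rule exI[of _ 1], rule exI[of _ w]) simp

lemma disk_automorphism_differentiable:
  assumes "A \<in> disk_automorphisms" "norm z < 1"
  obtains D where "(A has_field_derivative D) (at z)"
proof -
  obtain \<mu> w where A: "norm \<mu> = 1" "norm w < 1" "A = (\<lambda>z. \<mu> * blaschke_factor w z)"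
    using assms by (auto simp: disk_automorphisms_iff)
  have "1 - cnj w * z \<noteq> 0" using one_minus_cnj_mult_nonzero A assms by auto
  then have "A field_differentiable at z" unfolding A(3) blaschke_factor_def
    by (intro derivative_intros) auto
  then show ?thesis using that by (auto simp: field_differentiable_def)
qed

text \<open>
  The form \<open>B' \<circ> A = A \<circ> B\<close> of conjugacy avoids inverses and is the one used from here on.
\<close>

lemma disk_conjugate_iff:
  "disk_conjugate B B' \<longleftrightarrow> (\<exists>A\<in>disk_automorphisms. \<forall>z. norm z < 1 \<longrightarrow> B' (A z) = A (B z))"
proof -
  have "(\<forall>z\<in>\<bbbD>. B' z = (A \<circ> B \<circ> inv_into \<bbbD> A) z) \<longleftrightarrow> (\<forall>z. norm z < 1 \<longrightarrow> B' (A z) = A (B z))"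
    if A: "A \<in> disk_automorphisms" for A
  proof -
    obtain C where C: "C \<in> disk_automorphisms" "\<And>z. norm z < 1 \<Longrightarrow> A (C z) = z" "\<And>z. norm z < 1 \<Longrightarrow> C (A z) = z"
      using disk_automorphism_inverse A by metis
    have "inv_into \<bbbD> A z = C z" if "norm z < 1" for z
      using that C disk_automorphism_norm_less_1[OF C(1) that] 
      by (intro inv_into_f_eq inj_on_inverseI[of _ C]) auto
    then have *: "(\<forall>z\<in>\<bbbD>. B' z = (A \<circ> B \<circ> inv_into \<bbbD> A) z) \<longleftrightarrow> (\<forall>z. norm z < 1 \<longrightarrow> B' z = A (B (C z)))"
      by (simp add: Ball_def)
    show ?thesis
      unfolding *
    proof (intro iffI allI impI)
      fix z :: complex assume z: "norm z < 1" "\<forall>z. norm z < 1 \<longrightarrow> B' z = A (B (C z))"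
      then show "B' (A z) = A (B z)" using C(3)[OF z(1)] disk_automorphism_norm_less_1[OF A z(1)] by simp
    next
      fix z :: complex assume z: "norm z < 1" "\<forall>z. norm z < 1 \<longrightarrow> B' (A z) = A (B z)"
      then show "B' z = A (B (C z))" using C(2)[OF z(1)] disk_automorphism_norm_less_1[OF C(1) z(1)] by metis
    qed
  qed
  then show ?thesis unfolding disk_conjugate_def by auto
qed

section \<open>Composition of cubic Blaschke products with disk automorphisms\<close>

lemma cubic_blaschke_iff:
  "cubic_blaschke_product B \<longleftrightarrow>
    (\<exists>\<mu> u v w. norm \<mu> = 1 \<and> norm u < 1 \<and> norm v < 1 \<and> norm w < 1 \<and>
      (\<forall>z. norm z < 1 \<longrightarrow> B z = \<mu> * (blaschke_factor u z * blaschke_factor v z * blaschke_factor w z)))"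
proof -
  have 3: "{1..3::nat} = {1, 2, 3}" by auto
  show ?thesis
  proof
    assume "cubic_blaschke_product B"
    then obtain \<mu> and w :: "nat \<Rightarrow> complex" where "norm \<mu> = 1" "\<forall>i\<in>{1, 2, 3}. w i \<in> \<bbbD>"
      "\<forall>z\<in>\<bbbD>. B z = \<mu> * (\<Prod>i\<in>{1, 2, 3}. (z - w i) / (1 - cnj (w i) * z))"
      unfolding blaschke_product_def 3 by blast
    then show "\<exists>\<mu> u v w. norm \<mu> = 1 \<and> norm u < 1 \<and> norm v < 1 \<and> norm w < 1 \<and>
      (\<forall>z. norm z < 1 \<longrightarrow> B z = \<mu> * (blaschke_factor u z * blaschke_factor v z * blaschke_factor w z))"
      by (intro exI[of _ \<mu>] exI[of _ "w 1"] exI[of _ "w 2"] exI[of _ "w 3"])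
        (simp add: blaschke_factor_def mult.assoc)
  next
    assume "\<exists>\<mu> u v w. norm \<mu> = 1 \<and> norm u < 1 \<and> norm v < 1 \<and> norm w < 1 \<and>
      (\<forall>z. norm z < 1 \<longrightarrow> B z = \<mu> * (blaschke_factor u z * blaschke_factor v z * blaschke_factor w z))"
    then obtain \<mu> u v w where B: "norm \<mu> = 1" "norm u < 1" "norm v < 1" "norm w < 1"
      "\<And>z. norm z < 1 \<Longrightarrow> B z = \<mu> * (blaschke_factor u z * blaschke_factor v z * blaschke_factor w z)" by blast
    show "cubic_blaschke_product B"
      unfolding blaschke_product_def 3
      by (intro exI[of _ \<mu>] exI[of _ "\<lambda>i. if i = 1 then u else if i = 2 then v else w"])
        (use B in \<open>simp add: blaschke_factor_def mult.assoc\<close>)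
  qed
qed

text \<open>
  Each factor of \<open>B\<close> is itself a disk automorphism, so composing it with \<open>A\<close> gives again one Blaschke
  factor up to rotation.
\<close>

lemma cubic_blaschke_precompose:
  assumes "cubic_blaschke_product B" "A \<in> disk_automorphisms" "\<And>z. norm z < 1 \<Longrightarrow> B' z = B (A z)"
  shows "cubic_blaschke_product B'"
proof -
  have factor: "\<exists>\<mu> v. norm \<mu> = 1 \<and> norm v < 1 \<and> (\<forall>z. norm z < 1 \<longrightarrow> blaschke_factor u (A z) = \<mu> * blaschke_factor v z)"
    if u: "norm u < 1" for u
  proof -
    obtain C where "C \<in> disk_automorphisms" "\<And>z. norm z < 1 \<Longrightarrow> C z = blaschke_factor u (A z)"
      using disk_automorphism_compose blaschke_factor_disk_automorphism assms(2) u by metis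
    then show ?thesis unfolding disk_automorphisms_iff by metis
  qed
  obtain \<mu> u v w where B: "norm \<mu> = 1" "norm u < 1" "norm v < 1" "norm w < 1"
      "\<And>z. norm z < 1 \<Longrightarrow> B z = \<mu> * (blaschke_factor u z * blaschke_factor v z * blaschke_factor w z)"
    using assms(1) unfolding cubic_blaschke_iff by blast
  obtain \<mu>1 u' where 1: "norm \<mu>1 = 1" "norm u' < 1" "\<And>z. norm z < 1 \<Longrightarrow> blaschke_factor u (A z) = \<mu>1 * blaschke_factor u' z"
    using factor B(2) by blast
  obtain \<mu>2 v' where 2: "norm \<mu>2 = 1" "norm v' < 1" "\<And>z. norm z < 1 \<Longrightarrow> blaschke_factor v (A z) = \<mu>2 * blaschke_factor v' z"
    using factor B(3) by blast
  obtain \<mu>3 w' where 3: "norm \<mu>3 = 1" "norm w' < 1" "\<And>z. norm z < 1 \<Longrightarrow> blaschke_factor w (A z) = \<mu>3 * blaschke_factor w' z"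
    using factor B(4) by blast
  show ?thesis unfolding cubic_blaschke_iff
    by (rule exI[of _ "\<mu> * \<mu>1 * \<mu>2 * \<mu>3"], rule exI[of _ u'], rule exI[of _ v'], rule exI[of _ w'])
      (simp add: assms(3) B(1,5) 1 2 3 norm_mult disk_automorphism_norm_less_1[OF assms(2)])
qed

text \<open>
  The fundamental theorem of algebra for the polynomial type.
\<close>

lemma complex_poly_has_root:
  fixes p :: "complex poly"
  assumes "degree p > 0"
  shows "\<exists>z. poly p z = 0"
proof -
  have "coeff p (degree p) \<noteq> 0" "degree p \<in> {1..degree p}" using assms by auto
  then have "\<exists>i\<in>{1..degree p}. coeff p i \<noteq> 0" by blast
  then obtain z where "(\<Sum>i\<le>degree p. coeff p i * z ^ i) = 0"
    by (rule fundamental_theorem_of_algebra[of "coeff p" "degree p", OF disjI2])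
  then show ?thesis by (auto simp: poly_altdef)
qed

lemma monic_cubic_factorization:
  fixes a b c :: complex
  obtains u v w where "a = - (u + v + w)" "b = u * v + u * w + v * w" "c = - (u * v * w)"
proof -
  have "\<exists>u. poly [:c, b, a, 1:] u = 0"
    by (rule complex_poly_has_root) simp
  then obtain u where u: "poly [:c, b, a, 1:] u = 0" ..
  define m where "m = a + u"
  define n where "n = b + u * m"
  define d where "d = csqrt (m\<^sup>2 - 4 * n)"
  have d: "d * d = m * m - 4 * n" by (metis d_def power2_csqrt power2_eq_square)
  have prod: "((- m + d) / 2) * ((- m - d) / 2) = n"
    using d by (simp add: field_simps)
  have c: "c = - (u * n)" using u by (simp add: n_def m_def algebra_simps add_eq_0_iff)
  show ?thesis
  proof
    show "a = - (u + (- m + d) / 2 + (- m - d) / 2)" by (simp add: m_def field_simps)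
    have "b = n + u * (((- m + d) / 2) + ((- m - d) / 2))" by (simp add: n_def field_simps)
    then show "b = u * ((- m + d) / 2) + u * ((- m - d) / 2) + ((- m + d) / 2) * ((- m - d) / 2)"
      unfolding prod by (simp add: algebra_simps)
    show "c = - (u * ((- m + d) / 2) * ((- m - d) / 2))"
      using c prod by (simp add: mult.assoc)
  qed
qed

text \<open>
  Outside the open disk a Blaschke factor has modulus at least \<open>1\<close>.  This is written without the quotient,
  so that it also covers the pole.
\<close>

lemma norm_cnj_factor_le_outside:
  assumes "norm w < 1" "1 \<le> norm z"
  shows "norm (1 - cnj w * z) \<le> norm (z - w)" "z \<noteq> w"
proof -
  have "norm (1 - cnj w * z)^2 - norm (z - w)^2 \<le> 0"
    unfolding norm_blaschke_identity using assms 
    by (intro mult_nonneg_nonpos) (simp_all add: power_le_one)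
  then have "(norm (1 - cnj w * z))\<^sup>2 \<le> (norm (z - w))\<^sup>2" by linarith
  then show "norm (1 - cnj w * z) \<le> norm (z - w)" by (rule power2_le_imp_le) (rule norm_ge_zero)
  show "z \<noteq> w" using assms by (metis not_le)
qed

text \<open>
  Write \<open>B = \<mu> P / Q\<close>, where \<open>Q\<close> is the reciprocal polynomial of \<open>P\<close>.  Then \<open>A \<circ> B\<close> is a rotation of
  \<open>(\<mu> P - b Q) / (Q - cnj b \<mu> P)\<close>, whose denominator is up to a factor again the reciprocal polynomial of
  the numerator.  It remains to see that the roots of the numerator lie in the disk: at a root \<open>|P| = |b| |Q|\<close>,
  while \<open>|P| \<ge> |Q|\<close> and \<open>P \<noteq> 0\<close> outside the disk.
\<close>

lemma cubic_blaschke_postcompose: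
  assumes "cubic_blaschke_product B" "A \<in> disk_automorphisms" "\<And>z. norm z < 1 \<Longrightarrow> B' z = A (B z)"
  shows "cubic_blaschke_product B'"
proof -
  obtain \<mu> u v w where B: "norm \<mu> = 1" "norm u < 1" "norm v < 1" "norm w < 1"
      "\<And>z. norm z < 1 \<Longrightarrow> B z = \<mu> * (blaschke_factor u z * blaschke_factor v z * blaschke_factor w z)"
    using assms(1) unfolding cubic_blaschke_iff by blast
  obtain \<nu> b where A: "norm \<nu> = 1" "norm b < 1" "A = (\<lambda>z. \<nu> * blaschke_factor b z)"
    using assms by (auto simp: disk_automorphisms_iff)
  define P where "P = (\<lambda>z. (z - u) * (z - v) * (z - w))"
  define Q where "Q = (\<lambda>z. (1 - cnj u * z) * (1 - cnj v * z) * (1 - cnj w * z))"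
  \<comment> \<open>\<open>k\<close> is the leading coefficient of the new numerator \<open>\<mu> P - b Q\<close>.\<close>
  define k where "k = \<mu> + b * cnj (u * v * w)"
  have m: "\<mu> * cnj \<mu> = 1" using B(1) by (metis complex_norm_square of_real_1 one_power2)
  have "norm (b * cnj (u * v * w)) = norm b * (norm u * (norm v * norm w))" by (simp add: norm_mult mult.assoc)
  also have "\<dots> \<le> norm b * 1" using B by (intro mult_left_mono mult_le_one) auto
  also have "\<dots> < norm \<mu>" using A B by simp
  finally have k: "k \<noteq> 0" unfolding k_def 
    by (metis add_eq_0_iff less_irrefl norm_minus_cancel)
  obtain u' v' w' where r: "- (\<mu> * (u + v + w) + b * cnj (u * v + u * w + v * w)) / k = - (u' + v' + w')"
      "(\<mu> * (u * v + u * w + v * w) + b * cnj (u + v + w)) / k = u' * v' + u' * w' + v' * w'"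
      "- (\<mu> * (u * v * w) + b) / k = - (u' * v' * w')"
    by (rule monic_cubic_factorization)
  have quotient_minus_eqD: "x = k * y" if "- x / k = - y" for x y using that k by (simp add: field_simps)
  have quotient_eqD: "x = k * y" if "x / k = y" for x y using that k by (simp add: field_simps)
  have e: "\<mu> * (u + v + w) + b * cnj (u * v + u * w + v * w) = k * (u' + v' + w')"
    "\<mu> * (u * v + u * w + v * w) + b * cnj (u + v + w) = k * (u' * v' + u' * w' + v' * w')"
    "\<mu> * (u * v * w) + b = k * (u' * v' * w')"
    by (rule quotient_minus_eqD, fact r, rule quotient_eqD, fact r, rule quotient_minus_eqD, fact r)
  have num: "\<mu> * P z - b * Q z = k * ((z - u') * (z - v') * (z - w'))" for z
  proof -
    have "\<mu> * P z - b * Q z = k * z^3 - (\<mu> * (u + v + w) + b * cnj (u * v + u * w + v * w)) * z^2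
      + (\<mu> * (u * v + u * w + v * w) + b * cnj (u + v + w)) * z - (\<mu> * (u * v * w) + b)"
      by (simp add: P_def Q_def k_def algebra_simps power2_eq_square power3_eq_cube)
    also have "\<dots> = k * ((z - u') * (z - v') * (z - w'))"
      unfolding e by (simp add: algebra_simps power2_eq_square power3_eq_cube)
    finally show ?thesis .
  qed
  have den: "Q z - cnj b * (\<mu> * P z) = \<mu> * cnj k * ((1 - cnj u' * z) * (1 - cnj v' * z) * (1 - cnj w' * z))" for z
  proof -
    have m': "\<mu> * (cnj \<mu> * x) = x" for x using m by (simp flip: mult.assoc)
    have "Q z - cnj b * (\<mu> * P z) = \<mu> * cnj k - \<mu> * cnj (\<mu> * (u + v + w) + b * cnj (u * v + u * w + v * w)) * z
      + \<mu> * cnj (\<mu> * (u * v + u * w + v * w) + b * cnj (u + v + w)) * z^2 - \<mu> * cnj (\<mu> * (u * v * w) + b) * z^3"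
      by (simp add: P_def Q_def k_def algebra_simps power2_eq_square power3_eq_cube m m')
    also have "\<dots> = \<mu> * cnj k * ((1 - cnj u' * z) * (1 - cnj v' * z) * (1 - cnj w' * z))"
      unfolding e by (simp add: algebra_simps power2_eq_square power3_eq_cube)
    finally show ?thesis .
  qed
  have root: "norm x < 1" if "\<mu> * P x - b * Q x = 0" for x
  proof (rule ccontr)
    assume x: "\<not> norm x < 1"
    have "norm (Q x) \<le> norm (P x)" "P x \<noteq> 0"
      using x B norm_cnj_factor_le_outside by (auto simp: P_def Q_def norm_mult intro!: mult_mono)
    moreover have "norm (P x) = norm b * norm (Q x)"
      using that B(1) by (metis mult_1 norm_mult right_minus_eq)
    ultimately have "norm (Q x) \<le> norm b * norm (Q x)" "norm (Q x) > 0" by auto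
    then show False using A(2) by simp
  qed
  have r: "norm u' < 1" "norm v' < 1" "norm w' < 1" by (auto intro!: root simp: num)
  show ?thesis unfolding cubic_blaschke_iff
  proof (rule exI[of _ "\<nu> * (k / (\<mu> * cnj k))"], rule exI[of _ u'], rule exI[of _ v'], rule exI[of _ w'], intro conjI allI impI r)
    show "norm (\<nu> * (k / (\<mu> * cnj k))) = 1" using A B k by (simp add: norm_mult norm_divide)
    fix z :: complex assume z: "norm z < 1"
    have Q: "Q z \<noteq> 0" using one_minus_cnj_mult_nonzero z B by (auto simp: Q_def)
    have "B' z = A (\<mu> * P z / Q z)" using assms(3)[OF z] B(5)[OF z] by (simp add: P_def Q_def blaschke_factor_def)
    also have "\<dots> = \<nu> * ((\<mu> * P z - b * Q z) / (Q z - cnj b * (\<mu> * P z)))"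
    proof -
      have "\<mu> * P z / Q z - b = (\<mu> * P z - b * Q z) / Q z" "1 - cnj b * (\<mu> * P z / Q z) = (Q z - cnj b * (\<mu> * P z)) / Q z"
        using Q by (simp_all add: diff_divide_distrib)
      then show ?thesis using Q by (simp add: A(3) blaschke_factor_def)
    qed
    also have "\<dots> = \<nu> * (k / (\<mu> * cnj k)) * (blaschke_factor u' z * blaschke_factor v' z * blaschke_factor w' z)"
      unfolding num den by (simp add: blaschke_factor_def)
    finally show "B' z = \<nu> * (k / (\<mu> * cnj k)) * (blaschke_factor u' z * blaschke_factor v' z * blaschke_factor w' z)" .
  qed
qed

section \<open>Existence of a critical point\<close>

text \<open>
  The derivative of a product of three quotients over the common denominator \<open>(a b c)\<^sup>2\<close>.
\<close>

lemma product_rule_three_fractions: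
  fixes a b c :: complex
  assumes "a \<noteq> 0" "b \<noteq> 0" "c \<noteq> 0"
  shows "(u' / a\<^sup>2 * (v / b) + v' / b\<^sup>2 * (u / a)) * (w / c) + w' / c\<^sup>2 * (u / a * (v / b)) =
    (u' * ((v * b) * (w * c)) + v' * ((u * a) * (w * c)) + w' * ((u * a) * (v * b))) / (a * b * c)\<^sup>2"
proof -
  have "u' / a\<^sup>2 * (v / b) * (w / c) = u' * ((v * b) * (w * c)) / (a * b * c)\<^sup>2"
    using assms by (simp add: power2_eq_square ac_simps)
  moreover have "v' / b\<^sup>2 * (u / a) * (w / c) = v' * ((u * a) * (w * c)) / (a * b * c)\<^sup>2"
    using assms by (simp add: power2_eq_square ac_simps)
  moreover have "w' / c\<^sup>2 * (u / a * (v / b)) = w' * ((u * a) * (v * b)) / (a * b * c)\<^sup>2"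
    using assms by (simp add: power2_eq_square ac_simps)
  ultimately show ?thesis by (simp only: distrib_right add_divide_distrib)
qed

lemma blaschke_factor_deriv:
  assumes "norm w < 1" "norm z < 1"
  shows "(blaschke_factor w has_field_derivative (1 - w * cnj w) / (1 - cnj w * z)\<^sup>2) (at z)"
proof -
  have "((\<lambda>z. (z - w) / (1 - cnj w * z)) has_field_derivative
      ((1 - 0) * (1 - cnj w * z) - (z - w) * (0 - cnj w * 1)) / ((1 - cnj w * z) * (1 - cnj w * z))) (at z)"
    using one_minus_cnj_mult_nonzero assms by (intro derivative_intros) auto
  also have "(1 - 0) * (1 - cnj w * z) - (z - w) * (0 - cnj w * 1) = 1 - w * cnj w"
    by (simp add: algebra_simps)
  finally show ?thesis unfolding blaschke_factor_def[abs_def] power2_eq_square .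
qed

text \<open>
  The numerator \<open>N\<close> of the derivative is a quartic polynomial (possibly of lower degree) that equals its own
  reciprocal, so its roots come in pairs symmetric in the unit circle.  On the circle \<open>N z / z\<^sup>2\<close> is a sum of
  positive terms, so no root lies there.  Hence any root, or its mirror image, is in the disk.
\<close>

lemma cubic_blaschke_critical_point:
  assumes "cubic_blaschke_product B"
  obtains c where "norm c < 1" "(B has_field_derivative 0) (at c)"
proof -
  obtain \<mu> u v w where B: "norm \<mu> = 1" "norm u < 1" "norm v < 1" "norm w < 1"
      "\<And>z. norm z < 1 \<Longrightarrow> B z = \<mu> * (blaschke_factor u z * blaschke_factor v z * blaschke_factor w z)"
    using assms(1) unfolding cubic_blaschke_iff by blast
  define T where "T = (\<lambda>w z. (z - w) * (1 - cnj w * z))"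
  define N where "N = (\<lambda>z. (1 - u * cnj u) * (T v z * T w z) + (1 - v * cnj v) * (T u z * T w z)
    + (1 - w * cnj w) * (T u z * T v z))"
  have reflect_T: "z\<^sup>2 * cnj (T w (1 / cnj z)) = T w z" if "z \<noteq> 0" for w z
    using that by (simp add: T_def field_simps power2_eq_square)
  have reflect_N: "z ^ 4 * cnj (N (1 / cnj z)) = N z" if "z \<noteq> 0" for z
  proof -
    have "z ^ 4 = z\<^sup>2 * z\<^sup>2" by (simp add: power2_eq_square power4_eq_xxxx)
    then have "z ^ 4 * cnj (N (1 / cnj z)) = (1 - u * cnj u) * ((z\<^sup>2 * cnj (T v (1 / cnj z))) * (z\<^sup>2 * cnj (T w (1 / cnj z))))
      + (1 - v * cnj v) * ((z\<^sup>2 * cnj (T u (1 / cnj z))) * (z\<^sup>2 * cnj (T w (1 / cnj z))))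
      + (1 - w * cnj w) * ((z\<^sup>2 * cnj (T u (1 / cnj z))) * (z\<^sup>2 * cnj (T v (1 / cnj z))))"
      by (simp add: N_def algebra_simps)
    then show ?thesis unfolding reflect_T[OF that] N_def .
  qed
  have "N z \<noteq> 0" if z: "norm z = 1" for z
  proof -
    have zz: "z * cnj z = 1" using z by (metis complex_norm_square of_real_1 one_power2)
    have T: "T w z = z * of_real ((norm (z - w))\<^sup>2)" for w
    proof -
      have "z * of_real ((norm (z - w))\<^sup>2) = z * ((z - w) * cnj (z - w))" by (simp only: complex_norm_square)
      also have "\<dots> = (z - w) * (z * cnj z - cnj w * z)" by (simp add: algebra_simps)
      finally show ?thesis by (simp only: zz T_def)
    qed
    have w: "1 - w * cnj w = of_real (1 - (norm w)\<^sup>2)" for w by (simp add: complex_norm_square del: of_real_power)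
    have "(1 - (norm u)\<^sup>2) * ((norm (z - v))\<^sup>2 * (norm (z - w))\<^sup>2) > 0"
      "(1 - (norm v)\<^sup>2) * ((norm (z - u))\<^sup>2 * (norm (z - w))\<^sup>2) > 0"
      "(1 - (norm w)\<^sup>2) * ((norm (z - u))\<^sup>2 * (norm (z - v))\<^sup>2) > 0"
      using z B(2-4) by (auto intro!: mult_pos_pos simp: power_less_one_iff)
    moreover have "N z = z\<^sup>2 * of_real ((1 - (norm u)\<^sup>2) * ((norm (z - v))\<^sup>2 * (norm (z - w))\<^sup>2)
      + (1 - (norm v)\<^sup>2) * ((norm (z - u))\<^sup>2 * (norm (z - w))\<^sup>2)
      + (1 - (norm w)\<^sup>2) * ((norm (z - u))\<^sup>2 * (norm (z - v))\<^sup>2))"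
      unfolding N_def T w by (simp add: algebra_simps power2_eq_square)
    ultimately show ?thesis using z by (auto simp del: of_real_add of_real_mult of_real_diff simp: of_real_eq_0_iff)
  qed
  moreover have "\<exists>z. N z = 0"
  proof (rule ccontr)
    assume no: "\<nexists>z. N z = 0"
    define p where "p = (\<lambda>w. [:- w, 1:] * [:1, - cnj w:])"
    define q where "q = smult (1 - u * cnj u) (p v * p w) + smult (1 - v * cnj v) (p u * p w) + smult (1 - w * cnj w) (p u * p v)"
    have "poly (p w) z = T w z" for w z by (simp add: p_def T_def algebra_simps)
    then have q: "poly q z = N z" for z by (simp add: q_def N_def)
    have "poly q z \<noteq> 0" for z using no unfolding q by blast
    then have "degree q = 0" using complex_poly_has_root by blast
    then obtain k where "q = [:k:]" by (rule degree_eq_zeroE)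
    then have "N z = k" for z using q[of z] by simp
    then have c: "N z = N 0" for z by simp
    \<comment> \<open>A constant \<open>N\<close> cannot satisfy the reflection law at both \<open>1\<close> and \<open>2\<close>, where the factor \<open>z ^ 4\<close> differs.\<close>
    have "2 ^ 4 * cnj (N 0) = N 0" "1 ^ 4 * cnj (N 0) = N 0" 
      using reflect_N[of 2] reflect_N[of 1] unfolding c[of 1] c[of 2] by (simp_all add: c[of "1/2"] c[of 1])
    then show False using no by auto
  qed
  ultimately obtain z where z: "N z = 0" "norm z \<noteq> 1" by blast
  have "\<exists>c. norm c < 1 \<and> N c = 0"
  proof (cases "norm z < 1")
    case False
    then have "norm z > 1" using z(2) by simp
    then have "norm (1 / cnj z) < 1" by (simp add: norm_divide divide_less_eq)
    have "z \<noteq> 0" using \<open>norm z > 1\<close> by auto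
    moreover have "N (1 / cnj z) = 0" using reflect_N[of z] z \<open>z \<noteq> 0\<close> by simp
    ultimately show ?thesis using \<open>norm (1 / cnj z) < 1\<close> by blast
  qed (use z in auto)
  then obtain c where c: "norm c < 1" "N c = 0" by blast
  have nz: "1 - cnj u * c \<noteq> 0" "1 - cnj v * c \<noteq> 0" "1 - cnj w * c \<noteq> 0"
    using one_minus_cnj_mult_nonzero c B by auto
  have "((\<lambda>z. \<mu> * (blaschke_factor u z * blaschke_factor v z * blaschke_factor w z)) has_field_derivative
    \<mu> * (N c / ((1 - cnj u * c) * (1 - cnj v * c) * (1 - cnj w * c))\<^sup>2)) (at c)"
    using DERIV_cmult[OF DERIV_mult[OF DERIV_mult[OF blaschke_factor_deriv[OF B(2) c(1)] blaschke_factor_deriv[OF B(3) c(1)]]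
        blaschke_factor_deriv[OF B(4) c(1)]], of \<mu>]
    using product_rule_three_fractions[OF nz] by (simp only: blaschke_factor_def N_def T_def)
  then have "((\<lambda>z. \<mu> * (blaschke_factor u z * blaschke_factor v z * blaschke_factor w z)) has_field_derivative 0) (at c)"
    using c by simp
  then have "(B has_field_derivative 0) (at c)"
    by (rule has_field_derivative_transform_within_open[of _ _ _ \<bbbD>]) (use c B(5) in auto)
  then show ?thesis using that c by blast
qed

section \<open>Odd cubic Blaschke products\<close>

text \<open>
  Up to a rotation these are all the odd cubic Blaschke products with parameter in the disk; the zeros are \<open>0\<close> and the
  two square roots of \<open>cnj s\<close>.
\<close>

definition odd_cubic :: "complex \<Rightarrow> complex \<Rightarrow> complex" where
  "odd_cubic s z = (z ^ 3 - cnj s * z) / (1 - s * z\<^sup>2)"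

lemma cubic_blaschke_norm_less_1:
  assumes "cubic_blaschke_product B" "norm z < 1"
  shows "norm (B z) < 1"
proof -
  obtain \<mu> u v w where B: "norm \<mu> = 1" "norm u < 1" "norm v < 1" "norm w < 1"
      "B z = \<mu> * (blaschke_factor u z * blaschke_factor v z * blaschke_factor w z)"
    using assms unfolding cubic_blaschke_iff by blast
  have n: "norm (blaschke_factor w z) < 1" if "norm w < 1" for w
    using disk_automorphism_norm_less_1[OF blaschke_factor_disk_automorphism[OF that] assms(2)] .
  have "norm (B z) = norm (blaschke_factor u z) * norm (blaschke_factor v z) * norm (blaschke_factor w z)"
    using B by (simp add: norm_mult)
  also have "\<dots> \<le> 1 * norm (blaschke_factor w z)"
    using n[OF B(2)] n[OF B(3)] by (intro mult_right_mono mult_le_one) auto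
  also have "\<dots> < 1" using n[OF B(4)] by simp
  finally show ?thesis .
qed

lemma blaschke_factor_0 [simp]: "blaschke_factor 0 z = z" "blaschke_factor w 0 = - w"
  by (simp_all add: blaschke_factor_def)

lemma blaschke_factor_self [simp]: "blaschke_factor w w = 0"
  by (simp add: blaschke_factor_def)

lemma blaschke_factor_eq_0_iff:
  assumes "norm w < 1" "norm z < 1"
  shows "blaschke_factor w z = 0 \<longleftrightarrow> z = w"
  using one_minus_cnj_mult_nonzero[of w z] assms by (simp add: blaschke_factor_def)

lemma odd_cubic_factorization:
  assumes "norm v < 1" "norm z < 1"
  shows "odd_cubic (cnj (v\<^sup>2)) z = z * (blaschke_factor v z * blaschke_factor (- v) z)"
proof -
  have "blaschke_factor v z * blaschke_factor (- v) z = ((z - v) * (z + v)) / ((1 - cnj v * z) * (1 + cnj v * z))"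
    by (simp add: blaschke_factor_def)
  also have "\<dots> = (z\<^sup>2 - v\<^sup>2) / (1 - (cnj v)\<^sup>2 * z\<^sup>2)"
    by (simp add: algebra_simps power2_eq_square)
  finally show ?thesis by (simp add: odd_cubic_def power2_eq_square power3_eq_cube algebra_simps)
qed

lemma cubic_blaschke_odd_cubic:
  assumes "norm s < 1"
  shows "cubic_blaschke_product (odd_cubic s)"
proof -
  define v where "v = csqrt (cnj s)"
  have s: "s = cnj (v\<^sup>2)" by (simp only: v_def power2_csqrt complex_cnj_cnj)
  have v: "norm v < 1" using assms by (simp add: v_def norm_csqrt)
  show ?thesis unfolding cubic_blaschke_iff
    by (rule exI[of _ 1], rule exI[of _ 0], rule exI[of _ v], rule exI[of _ "- v"])
      (simp add: v s odd_cubic_factorization del: complex_cnj_power)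
qed

section \<open>Reduction to an odd map\<close>

text \<open>
  Equivalence under independent changes of coordinate in the source and in the target.  It is the relation in
  which a critical point and its value can be normalised separately; conjugacy is recovered only at the end.
\<close>

definition disk_equivalent :: "(complex \<Rightarrow> complex) \<Rightarrow> (complex \<Rightarrow> complex) \<Rightarrow> bool" where
  "disk_equivalent B B' \<longleftrightarrow>
    (\<exists>A\<in>disk_automorphisms. \<exists>C\<in>disk_automorphisms. \<forall>z. norm z < 1 \<longrightarrow> B (A z) = C (B' z))"

lemma disk_equivalentI:
  assumes "A \<in> disk_automorphisms" "C \<in> disk_automorphisms" "\<And>z. norm z < 1 \<Longrightarrow> B (A z) = C (B' z)"
  shows "disk_equivalent B B'"
  using assms unfolding disk_equivalent_def by blast

lemma disk_equivalent_trans: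
  assumes "disk_equivalent B B'" "disk_equivalent B' B''" "\<And>z. norm z < 1 \<Longrightarrow> norm (B'' z) < 1"
  shows "disk_equivalent B B''"
proof -
  obtain A C where 1: "A \<in> disk_automorphisms" "C \<in> disk_automorphisms" "\<And>z. norm z < 1 \<Longrightarrow> B (A z) = C (B' z)"
    using assms unfolding disk_equivalent_def by blast
  obtain A' C' where 2: "A' \<in> disk_automorphisms" "C' \<in> disk_automorphisms" "\<And>z. norm z < 1 \<Longrightarrow> B' (A' z) = C' (B'' z)"
    using assms unfolding disk_equivalent_def by blast
  obtain A1 where A1: "A1 \<in> disk_automorphisms" "\<And>z. norm z < 1 \<Longrightarrow> A1 z = A (A' z)"
    using disk_automorphism_compose 1(1) 2(1) by metis
  obtain C1 where C1: "C1 \<in> disk_automorphisms" "\<And>z. norm z < 1 \<Longrightarrow> C1 z = C (C' z)"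
    using disk_automorphism_compose 1(2) 2(2) by metis
  show ?thesis
    by (rule disk_equivalentI[OF A1(1) C1(1)])
      (simp add: A1(2) C1(2) assms(3) 1(3) 2(3) disk_automorphism_norm_less_1[OF 2(1)])
qed

lemma cubic_blaschke_disk_equivalent:
  assumes "cubic_blaschke_product B" "A \<in> disk_automorphisms" "C \<in> disk_automorphisms"
  shows "disk_equivalent B (\<lambda>z. C (B (A z)))" "cubic_blaschke_product (\<lambda>z. C (B (A z)))"
proof -
  obtain C' where C': "C' \<in> disk_automorphisms" "\<And>z. norm z < 1 \<Longrightarrow> C' (C z) = z"
    using disk_automorphism_inverse assms(3) by metis
  show "disk_equivalent B (\<lambda>z. C (B (A z)))"
    by (rule disk_equivalentI[OF assms(2) C'(1)])
      (simp add: C' cubic_blaschke_norm_less_1[OF assms(1)] disk_automorphism_norm_less_1[OF assms(2)])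
  have "cubic_blaschke_product (\<lambda>z. B (A z))"
    by (rule cubic_blaschke_precompose[OF assms(1,2)]) simp
  then show "cubic_blaschke_product (\<lambda>z. C (B (A z)))"
    by (rule cubic_blaschke_postcompose[OF _ assms(3)]) simp
qed

lemma critical_point_transport:
  assumes "A \<in> disk_automorphisms" "C \<in> disk_automorphisms" "norm z < 1"
    and "(B has_field_derivative 0) (at (A z))" "norm (B (A z)) < 1"
    and "\<And>x. norm x < 1 \<Longrightarrow> B' x = C (B (A x))"
  shows "(B' has_field_derivative 0) (at z)"
proof -
  obtain D where D: "(A has_field_derivative D) (at z)"
    using disk_automorphism_differentiable assms by blast
  obtain E where E: "(C has_field_derivative E) (at (B (A z)))"
    using disk_automorphism_differentiable assms by blast
  have "((\<lambda>x. C (B (A x))) has_field_derivative E * (0 * D)) (at z)"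
    by (rule DERIV_chain2[OF E DERIV_chain2[OF assms(4) D]])
  then have "((\<lambda>x. C (B (A x))) has_field_derivative 0) (at z)" by simp
  then show ?thesis
    by (rule has_field_derivative_transform_within_open[of _ _ _ \<bbbD>]) (use assms in auto)
qed

lemma cubic_blaschke_fixing_0:
  assumes "cubic_blaschke_product B" "B 0 = 0"
  obtains \<mu> v w where "norm \<mu> = 1" "norm v < 1" "norm w < 1"
    "\<And>z. norm z < 1 \<Longrightarrow> B z = \<mu> * (z * (blaschke_factor v z * blaschke_factor w z))"
proof -
  obtain \<mu> u v w where B: "norm \<mu> = 1" "norm u < 1" "norm v < 1" "norm w < 1"
      "\<And>z. norm z < 1 \<Longrightarrow> B z = \<mu> * (blaschke_factor u z * blaschke_factor v z * blaschke_factor w z)"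
    using assms(1) unfolding cubic_blaschke_iff by blast
  have "\<mu> * (blaschke_factor u 0 * blaschke_factor v 0 * blaschke_factor w 0) = 0"
    using B(5)[of 0] assms(2) by simp
  moreover have "\<mu> \<noteq> 0" using B(1) by auto
  ultimately consider "u = 0" | "v = 0" | "w = 0" by auto
  then show ?thesis
  proof cases
    case 1
    then show ?thesis by (intro that[OF B(1,3,4)]) (simp add: B(5) mult.assoc)
  next
    case 2
    then show ?thesis by (intro that[OF B(1,2,4)]) (simp add: B(5) mult_ac)
  next
    case 3
    then show ?thesis by (intro that[OF B(1,2,3)]) (simp add: B(5) mult_ac)
  qed
qed

lemma cubic_blaschke_double_zero:
  assumes "cubic_blaschke_product B" "B 0 = 0" "(B has_field_derivative 0) (at 0)"
  obtains \<mu> w where "norm \<mu> = 1" "norm w < 1" "\<And>z. norm z < 1 \<Longrightarrow> B z = \<mu> * (z\<^sup>2 * blaschke_factor w z)"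
proof -
  obtain \<mu> v w where B: "norm \<mu> = 1" "norm v < 1" "norm w < 1"
    "\<And>z. norm z < 1 \<Longrightarrow> B z = \<mu> * (z * (blaschke_factor v z * blaschke_factor w z))"
    using cubic_blaschke_fixing_0 assms by blast
  obtain D where D: "((\<lambda>z. blaschke_factor v z * blaschke_factor w z) has_field_derivative D) (at 0)"
    using DERIV_mult blaschke_factor_deriv[of _ 0] B(2,3) norm_zero zero_less_one by metis
  have "((\<lambda>z. \<mu> * (z * (blaschke_factor v z * blaschke_factor w z))) has_field_derivative \<mu> * (1 * (v * w) + D * 0)) (at 0)"
    using DERIV_cmult[OF DERIV_mult[OF DERIV_ident D], of \<mu>] by simp
  then have "(B has_field_derivative \<mu> * (1 * (v * w) + D * 0)) (at 0)"
    by (rule has_field_derivative_transform_within_open[of _ _ _ \<bbbD>]) (use B(4) in auto)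
  then have "\<mu> * (1 * (v * w) + D * 0) = 0" using DERIV_unique assms(3) by blast
  moreover have "\<mu> \<noteq> 0" using B(1) by auto
  ultimately have "v = 0 \<or> w = 0" by simp
  then show ?thesis
  proof
    assume "v = 0"
    then show ?thesis by (intro that[OF B(1,3)]) (simp add: B(4) power2_eq_square)
  next
    assume "w = 0"
    then show ?thesis by (intro that[OF B(1,2)]) (simp add: B(4) power2_eq_square)
  qed
qed

lemma cubic_blaschke_double_zero_form:
  assumes "norm w < 1"
  shows "cubic_blaschke_product (\<lambda>z. z\<^sup>2 * blaschke_factor w z)"
  unfolding cubic_blaschke_iff
  by (rule exI[of _ 1], rule exI[of _ 0], rule exI[of _ 0], rule exI[of _ w])
    (simp add: assms power2_eq_square)

text \<open>
  Move a critical point to \<open>0\<close> and its value to \<open>0\<close>.  This gives a double zero at \<open>0\<close>, and a rotation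
  makes the remaining zero real and nonpositive.
\<close>

lemma real_double_zero_form:
  assumes "cubic_blaschke_product B"
  obtains p :: real where "0 \<le> p" "p < 1" "disk_equivalent B (\<lambda>z. z\<^sup>2 * blaschke_factor (- of_real p) z)"
proof -
  obtain c where c: "norm c < 1" "(B has_field_derivative 0) (at c)"
    using cubic_blaschke_critical_point assms by blast
  define A where "A = blaschke_factor (- c)"
  define C where "C = blaschke_factor (B c)"
  have A: "A \<in> disk_automorphisms" "A 0 = c" using c by (auto simp: A_def intro: blaschke_factor_disk_automorphism)
  have C: "C \<in> disk_automorphisms" "C (B c) = 0"
    using cubic_blaschke_norm_less_1[OF assms c(1)] by (auto simp: C_def intro: blaschke_factor_disk_automorphism)
  define B' where "B' = (\<lambda>z. C (B (A z)))"
  have B': "disk_equivalent B B'" "cubic_blaschke_product B'"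
    unfolding B'_def by (rule cubic_blaschke_disk_equivalent[OF assms A(1) C(1)])+
  have "(B' has_field_derivative 0) (at 0)"
    by (rule critical_point_transport[OF A(1) C(1)])
      (use c A(2) cubic_blaschke_norm_less_1[OF assms c(1)] in \<open>auto simp: B'_def\<close>)
  moreover have "B' 0 = 0" by (simp add: B'_def A C)
  ultimately obtain \<mu> w where w: "norm \<mu> = 1" "norm w < 1" "\<And>z. norm z < 1 \<Longrightarrow> B' z = \<mu> * (z\<^sup>2 * blaschke_factor w z)"
    using cubic_blaschke_double_zero B'(2) by blast
  \<comment> \<open>The unit vector opposite to \<open>w\<close>, so that rotating by it turns \<open>w\<close> into \<open>- |w|\<close>.\<close>
  define l where "l = (if w = 0 then 1 else - w / of_real (norm w))"
  have l: "norm l = 1" "w = - (of_real (norm w) * l)" by (auto simp: l_def norm_divide)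
  have ll: "cnj l * l = 1" using l(1) by (metis complex_norm_square of_real_1 one_power2 mult.commute)
  have rot: "blaschke_factor w (l * z) = l * blaschke_factor (- of_real (norm w)) z" for z
  proof -
    have "cnj w * (l * z) = - (of_real (norm w) * (cnj l * l) * z)" by (subst l(2)) simp
    moreover have "l * z - w = l * (z + of_real (norm w))" by (subst l(2)) (simp add: algebra_simps)
    ultimately show ?thesis unfolding ll by (simp add: blaschke_factor_def)
  qed
  have "disk_equivalent B' (\<lambda>z. z\<^sup>2 * blaschke_factor (- of_real (norm w)) z)"
  proof (rule disk_equivalentI)
    show "(\<lambda>z. l * z) \<in> disk_automorphisms" "(\<lambda>z. (\<mu> * l ^ 3) * z) \<in> disk_automorphisms"
      by (rule rotation_disk_automorphism, simp add: l w norm_mult norm_power)+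
    fix z :: complex assume "norm z < 1"
    then have "norm (l * z) < 1" by (simp add: norm_mult l)
    then show "B' (l * z) = (\<mu> * l ^ 3) * (z\<^sup>2 * blaschke_factor (- of_real (norm w)) z)"
      by (simp add: w(3) rot power2_eq_square power3_eq_cube)
  qed
  then have "disk_equivalent B (\<lambda>z. z\<^sup>2 * blaschke_factor (- of_real (norm w)) z)"
    by (rule disk_equivalent_trans[OF B'(1)])
      (intro cubic_blaschke_norm_less_1[OF cubic_blaschke_double_zero_form], use w in auto)
  then show ?thesis using that[of "norm w"] w by auto
qed

text \<open>
  The zero set of an odd function is symmetric, so besides \<open>0\<close> the zeros are \<open>v\<close> and \<open>- v\<close>.
\<close>

lemma odd_cubic_blaschke:
  assumes "cubic_blaschke_product B" "\<And>z. norm z < 1 \<Longrightarrow> B (- z) = - B z"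
  obtains \<mu> s where "norm \<mu> = 1" "norm s < 1" "\<And>z. norm z < 1 \<Longrightarrow> B z = \<mu> * odd_cubic s z"
proof -
  have "B 0 = 0" using assms(2)[of 0] by simp
  then obtain \<mu> v w where B: "norm \<mu> = 1" "norm v < 1" "norm w < 1"
    "\<And>z. norm z < 1 \<Longrightarrow> B z = \<mu> * (z * (blaschke_factor v z * blaschke_factor w z))"
    using cubic_blaschke_fixing_0 assms by blast
  have zero: "B z = 0 \<longleftrightarrow> z = 0 \<or> z = v \<or> z = w" if "norm z < 1" for z
    using that B by (auto simp: blaschke_factor_eq_0_iff)
  have "B (- v) = - B v" "B (- w) = - B w" using assms(2) B(2,3) by blast+
  then have "B (- v) = 0" "B (- w) = 0" using zero[OF B(2)] zero[OF B(3)] by simp_all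
  then have "- v = 0 \<or> - v = v \<or> - v = w" "- w = 0 \<or> - w = v \<or> - w = w"
    using zero[of "- v"] zero[of "- w"] B(2,3) by simp_all
  then have "w = - v" by (auto simp: eq_neg_iff_add_eq_0)
  moreover have "norm (cnj (v\<^sup>2)) < 1" using B(2) by (simp add: norm_power power_less_one_iff)
  ultimately show ?thesis
    by (intro that[OF B(1), of "cnj (v\<^sup>2)"]) (use B in \<open>simp_all add: odd_cubic_factorization del: complex_cnj_power\<close>)
qed

text \<open>
  The equation says that the map with double zero at \<open>0\<close> and simple zero at \<open>- p\<close> has no quadratic term
  once the base point \<open>a\<close> and its value have been moved to \<open>0\<close>.  Geometrically \<open>a\<close> is the hyperbolic midpoint
  of the two critical points.  One of these is \<open>0\<close> and the other lies between \<open>- p\<close> and \<open>0\<close>, which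
  suggests where to look for a change of sign.
\<close>

lemma balanced_base_point:
  fixes p :: real
  assumes "0 \<le> p" "p < 1"
  obtains a where "-1 < a" "a < 1"
    "(1 + p * a) * ((a + p) + 2 * a * (1 + p * a)) = a\<^sup>2 * (a + p) * (a\<^sup>2 * (1 + p * a) + 2 * a * (a + p))"
proof -
  define h where "h = (\<lambda>a. (1 + p * a) * ((a + p) + 2 * a * (1 + p * a)) - a\<^sup>2 * (a + p) * (a\<^sup>2 * (1 + p * a) + 2 * a * (a + p)))"
  have "h (- p) = - (2 * p * (1 - p * p)\<^sup>2)" by (simp add: h_def power2_eq_square)
  then have "h (- p) \<le> 0" using assms by simp
  moreover have "0 \<le> h 0" using assms by (simp add: h_def)
  ultimately have "\<exists>a. - p \<le> a \<and> a \<le> 0 \<and> h a = 0"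
    using assms by (intro IVT') (auto simp: h_def intro!: continuous_intros)
  then obtain a where "- p \<le> a" "a \<le> 0" "h a = 0" by blast
  then show ?thesis using assms by (intro that[of a]) (auto simp: h_def)
qed

text \<open>
  Based at the midpoint \<open>a\<close> of its critical points, the map has neither a constant nor a quadratic term in
  its numerator \<open>K z\<^sup>3 + L z\<close>.  The denominator is the reciprocal polynomial \<open>K + L z\<^sup>2\<close>, so the map is odd.
\<close>

lemma double_zero_form_equivalent_odd:
  fixes p :: real
  assumes "0 \<le> p" "p < 1"
  obtains s where "norm s < 1" "disk_equivalent (\<lambda>z. z\<^sup>2 * blaschke_factor (- of_real p) z) (odd_cubic s)"
proof -
  obtain a where a: "-1 < a" "a < 1"
    "(1 + p * a) * ((a + p) + 2 * a * (1 + p * a)) = a\<^sup>2 * (a + p) * (a\<^sup>2 * (1 + p * a) + 2 * a * (a + p))"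
    using balanced_base_point assms by blast
  define f where "f = (\<lambda>z. z\<^sup>2 * blaschke_factor (- of_real p) z)"
  \<comment> \<open>The inner change of coordinate turns \<open>z + p\<close> and \<open>1 + p z\<close> into \<open>m z + n\<close> and \<open>m + n z\<close>.\<close>
  define m n x where "m = complex_of_real (1 + p * a)" and "n = complex_of_real (a + p)" and "x = complex_of_real a"
  have "m * (n + 2 * x * m) = complex_of_real ((1 + p * a) * ((a + p) + 2 * a * (1 + p * a)))"
    by (simp add: m_def n_def x_def)
  also have "\<dots> = x\<^sup>2 * n * (x\<^sup>2 * m + 2 * x * n)"
    unfolding a(3) by (simp add: m_def n_def x_def)
  finally have balance: "m * (n + 2 * x * m) = x\<^sup>2 * n * (x\<^sup>2 * m + 2 * x * n)" .
  have "\<bar>p * a\<bar> < 1" using assms a mult_strict_mono'[of "\<bar>p\<bar>" 1 "\<bar>a\<bar>" 1] by (auto simp: abs_mult)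
  then have "1 + p * a \<noteq> 0" by linarith
  then have m: "m \<noteq> 0" by (metis m_def of_real_eq_0_iff)
  have f: "cubic_blaschke_product f" unfolding f_def using assms by (intro cubic_blaschke_double_zero_form) simp
  have x: "norm x < 1" using a by (simp add: x_def)
  define A where "A = blaschke_factor (- x)"
  define C where "C = blaschke_factor (f x)"
  have A: "A \<in> disk_automorphisms" using x by (auto simp: A_def intro: blaschke_factor_disk_automorphism)
  have C: "C \<in> disk_automorphisms"
    using cubic_blaschke_norm_less_1[OF f x] by (auto simp: C_def intro: blaschke_factor_disk_automorphism)
  define g where "g = (\<lambda>z. C (f (A z)))"
  have g: "disk_equivalent f g" "cubic_blaschke_product g"
    unfolding g_def by (rule cubic_blaschke_disk_equivalent[OF f A C])+
  have fx: "f x = x\<^sup>2 * n / m" by (simp add: f_def blaschke_factor_def x_def n_def m_def add.commute)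
  have "cnj (f x) = f x" unfolding fx by (simp add: x_def n_def m_def)
  define K where "K = m\<^sup>2 - x ^ 4 * n\<^sup>2"
  define L where "L = m * (x\<^sup>2 * m + 2 * x * n) - x\<^sup>2 * n * (2 * x * m + n)"
  have gz: "g z = (K * z ^ 3 + L * z) / (K + L * z\<^sup>2)" if z: "norm z < 1" for z
  proof -
    define P where "P = (z + x)\<^sup>2 * (m * z + n)"
    define Q where "Q = (1 + x * z)\<^sup>2 * (m + n * z)"
    have d: "1 + x * z \<noteq> 0" using one_minus_cnj_mult_nonzero[of "- x" z] x z by (simp add: x_def)
    have Az: "A z = (z + x) / (1 + x * z)" by (simp add: A_def blaschke_factor_def x_def)
    have "1 - cnj (- of_real p) * A z \<noteq> 0"
      using disk_automorphism_norm_less_1[OF A z] assms by (intro one_minus_cnj_mult_nonzero) auto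
    then have d2: "1 + of_real p * A z \<noteq> 0" by simp
    have 1: "(1 + of_real p * A z) * (1 + x * z) = m + n * z" "(A z + of_real p) * (1 + x * z) = m * z + n"
      using d by (simp_all add: Az m_def n_def x_def field_simps)
    have Q: "Q \<noteq> 0" using d d2 by (simp add: Q_def flip: 1)
    have "f (A z) = (A z)\<^sup>2 * (((A z + of_real p) * (1 + x * z)) / ((1 + of_real p * A z) * (1 + x * z)))"
      using d by (simp add: f_def blaschke_factor_def)
    also have "\<dots> = P / Q" unfolding 1 by (simp add: Az P_def Q_def power_divide)
    finally have fA: "f (A z) = P / Q" .
    have "f (A z) - f x = (m * P - x\<^sup>2 * n * Q) / (m * Q)"
      unfolding fA fx using Q m by (simp add: diff_divide_distrib)
    moreover have "1 - f x * f (A z) = (m * Q - x\<^sup>2 * n * P) / (m * Q)"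
      unfolding fA fx using Q m by (simp add: diff_divide_distrib)
    ultimately have "g z = (m * P - x\<^sup>2 * n * Q) / (m * Q - x\<^sup>2 * n * P)"
      using Q m by (simp add: g_def C_def blaschke_factor_def \<open>cnj (f x) = f x\<close>)
    also have "m * P - x\<^sup>2 * n * Q = K * z ^ 3 + L * z + (m * (n + 2 * x * m) - x\<^sup>2 * n * (x\<^sup>2 * m + 2 * x * n)) * z\<^sup>2"
      by (simp add: P_def Q_def K_def L_def algebra_simps power2_eq_square power3_eq_cube power4_eq_xxxx)
    also have "m * Q - x\<^sup>2 * n * P = K + L * z\<^sup>2 + (m * (n + 2 * x * m) - x\<^sup>2 * n * (x\<^sup>2 * m + 2 * x * n)) * z"
      by (simp add: P_def Q_def K_def L_def algebra_simps power2_eq_square power3_eq_cube power4_eq_xxxx)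
    finally show ?thesis by (simp add: balance)
  qed
  have "g (- z) = - g z" if "norm z < 1" for z
  proof -
    have "g (- z) = - (K * z ^ 3 + L * z) / (K + L * z\<^sup>2)" using that by (simp add: gz)
    then show ?thesis using that by (simp only: gz minus_divide_left)
  qed
  then obtain \<mu> s where s: "norm \<mu> = 1" "norm s < 1" "\<And>z. norm z < 1 \<Longrightarrow> g z = \<mu> * odd_cubic s z"
    using odd_cubic_blaschke g(2) by blast
  have "disk_equivalent g (odd_cubic s)"
    using s by (intro disk_equivalentI[of "\<lambda>z. 1 * z" "\<lambda>z. \<mu> * z"] rotation_disk_automorphism) auto
  then have "disk_equivalent f (odd_cubic s)"
    by (rule disk_equivalent_trans[OF g(1)]) (rule cubic_blaschke_norm_less_1[OF cubic_blaschke_odd_cubic[OF s(2)]])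
  then show ?thesis using that s(2) by (simp add: f_def)
qed

lemma cubic_blaschke_equivalent_odd:
  assumes "cubic_blaschke_product B"
  obtains s where "norm s < 1" "disk_equivalent B (odd_cubic s)"
proof -
  obtain p :: real where p: "0 \<le> p" "p < 1" "disk_equivalent B (\<lambda>z. z\<^sup>2 * blaschke_factor (- of_real p) z)"
    using real_double_zero_form assms by blast
  obtain s where s: "norm s < 1" "disk_equivalent (\<lambda>z. z\<^sup>2 * blaschke_factor (- of_real p) z) (odd_cubic s)"
    using double_zero_form_equivalent_odd p(1,2) by blast
  have "disk_equivalent B (odd_cubic s)"
    by (rule disk_equivalent_trans[OF p(3) s(2)])
      (rule cubic_blaschke_norm_less_1[OF cubic_blaschke_odd_cubic[OF s(1)]])
  then show ?thesis using that s(1) by blast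
qed

section \<open>Normal forms up to conjugacy\<close>

lemma one_minus_mult_square_nonzero:
  fixes s z :: complex
  assumes "norm s < 1" "norm z < 1"
  shows "1 - s * z\<^sup>2 \<noteq> 0"
  using one_minus_cnj_mult_nonzero[of "cnj s" "z\<^sup>2"] assms by (simp add: norm_power power_le_one)

text \<open>
  Both normal forms are an odd Blaschke product followed by a disk automorphism.
\<close>

lemma blaschke_factor_odd_cubic:
  assumes "norm s < 1" "norm z < 1"
  shows "blaschke_factor (- r) (odd_cubic s z) =
    (z ^ 3 - s * r * z\<^sup>2 - cnj s * z + r) / (cnj r * z ^ 3 - s * z\<^sup>2 - cnj (s * r) * z + 1)"
proof -
  define d where "d = 1 - s * z\<^sup>2"
  have d: "d \<noteq> 0" using one_minus_mult_square_nonzero assms by (simp add: d_def)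
  have "odd_cubic s z - - r = (z ^ 3 - cnj s * z + r * d) / d"
    "1 - cnj (- r) * odd_cubic s z = (d + cnj r * (z ^ 3 - cnj s * z)) / d"
    using d by (simp_all add: odd_cubic_def d_def[symmetric] add_divide_distrib)
  then have "blaschke_factor (- r) (odd_cubic s z) = (z ^ 3 - cnj s * z + r * d) / (d + cnj r * (z ^ 3 - cnj s * z))"
    using d by (simp add: blaschke_factor_def)
  also have "z ^ 3 - cnj s * z + r * d = z ^ 3 - s * r * z\<^sup>2 - cnj s * z + r" by (simp add: d_def algebra_simps)
  also have "d + cnj r * (z ^ 3 - cnj s * z) = cnj r * z ^ 3 - s * z\<^sup>2 - cnj (s * r) * z + 1" by (simp add: d_def algebra_simps)
  finally show ?thesis .
qed

lemma form_b_eq: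
  assumes "norm s < 1" "norm z < 1"
  shows "form_b r s z = blaschke_factor (- r) (odd_cubic s z)"
  unfolding blaschke_factor_odd_cubic[OF assms] form_b_def ..

lemma form_a_eq:
  assumes "\<bar>s0\<bar> < 1" "norm z < 1"
  shows "form_a \<mu> s0 r0 z = \<mu> * blaschke_factor (- r0) (odd_cubic (of_real (s0\<^sup>2)) z)"
proof -
  have "norm (complex_of_real (s0\<^sup>2)) < 1" using assms by (simp add: norm_power abs_square_less_1)
  then show ?thesis unfolding form_a_def by (subst blaschke_factor_odd_cubic) (use assms in simp_all)
qed

lemma norm_1_cnj: "norm \<kappa> = 1 \<Longrightarrow> cnj \<kappa> * \<kappa> = 1"
  by (metis complex_norm_square of_real_1 one_power2 mult.commute)

lemma blaschke_factor_rotate: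
  assumes "norm \<kappa> = 1"
  shows "blaschke_factor w (\<kappa> * z) = \<kappa> * blaschke_factor (w * cnj \<kappa>) z"
proof -
  have "\<kappa> * (z - w * cnj \<kappa>) = \<kappa> * z - w * (cnj \<kappa> * \<kappa>)" by (simp add: algebra_simps)
  then have "\<kappa> * z - w = \<kappa> * (z - w * cnj \<kappa>)" by (simp add: norm_1_cnj[OF assms])
  then show ?thesis by (simp add: blaschke_factor_def mult.assoc)
qed

text \<open>
  Rotating the source turns the parameter \<open>s\<close> by the square of the rotation factor.  This is the freedom
  that distinguishes the two normal forms.
\<close>

lemma odd_cubic_rotate:
  assumes "norm \<kappa> = 1"
  shows "odd_cubic s (\<kappa> * z) = \<kappa> ^ 3 * odd_cubic (s * \<kappa>\<^sup>2) z"
proof -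
  have "\<kappa> ^ 3 * (z ^ 3 - cnj (s * \<kappa>\<^sup>2) * z) = (\<kappa> * z) ^ 3 - cnj s * (cnj \<kappa> * \<kappa>) * (cnj \<kappa> * \<kappa>) * (\<kappa> * z)"
    by (simp add: algebra_simps power2_eq_square power3_eq_cube)
  then have "(\<kappa> * z) ^ 3 - cnj s * (\<kappa> * z) = \<kappa> ^ 3 * (z ^ 3 - cnj (s * \<kappa>\<^sup>2) * z)"
    by (simp only: norm_1_cnj[OF assms] mult_1_right)
  then show ?thesis by (simp add: odd_cubic_def power_mult_distrib mult.assoc)
qed

lemma odd_cubic_norm_less_1: "norm s < 1 \<Longrightarrow> norm z < 1 \<Longrightarrow> norm (odd_cubic s z) < 1"
  by (rule cubic_blaschke_norm_less_1[OF cubic_blaschke_odd_cubic])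

lemma disk_conjugate_cubic_blaschke:
  assumes "disk_conjugate B B'" "cubic_blaschke_product B"
  shows "cubic_blaschke_product B'"
proof -
  obtain M where M: "M \<in> disk_automorphisms" "\<And>z. norm z < 1 \<Longrightarrow> B' (M z) = M (B z)"
    using assms(1) unfolding disk_conjugate_iff by blast
  obtain M' where M': "M' \<in> disk_automorphisms" "\<And>z. norm z < 1 \<Longrightarrow> M (M' z) = z"
    using disk_automorphism_inverse M(1) by metis
  have "cubic_blaschke_product (\<lambda>z. B (M' z))"
    by (rule cubic_blaschke_precompose[OF assms(2) M'(1)]) simp
  then show ?thesis
  proof (rule cubic_blaschke_postcompose[OF _ M(1)])
    fix z :: complex assume z: "norm z < 1"
    show "B' z = M (B (M' z))"
      using M(2)[OF disk_automorphism_norm_less_1[OF M'(1) z]] M'(2)[OF z] by simp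
  qed
qed

text \<open>
  If \<open>B \<circ> A = C \<circ> odd_cubic s\<close>, then conjugation by the inverse of \<open>A\<close> leaves only an automorphism
  \<open>\<nu> * blaschke_factor w\<close> after the odd map.  A further conjugation by the rotation \<open>cnj \<kappa>\<close> multiplies
  both \<open>\<nu>\<close> and \<open>s\<close> by \<open>\<kappa>\<^sup>2\<close>.
\<close>

lemma cubic_blaschke_conjugate_family:
  assumes "cubic_blaschke_product B"
  obtains \<nu> w s where "norm \<nu> = 1" "norm w < 1" "norm s < 1"
    "\<And>\<kappa> F. \<lbrakk>norm \<kappa> = 1; \<And>z. norm z < 1 \<Longrightarrow> F z = \<nu> * \<kappa>\<^sup>2 * blaschke_factor (w * cnj (\<kappa> ^ 3)) (odd_cubic (s * \<kappa>\<^sup>2) z)\<rbrakk>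
      \<Longrightarrow> disk_conjugate B F"
proof -
  obtain s where s: "norm s < 1" "disk_equivalent B (odd_cubic s)"
    using cubic_blaschke_equivalent_odd assms by blast
  then obtain A C where AC: "A \<in> disk_automorphisms" "C \<in> disk_automorphisms"
    "\<And>z. norm z < 1 \<Longrightarrow> B (A z) = C (odd_cubic s z)" unfolding disk_equivalent_def by blast
  obtain A' where A': "A' \<in> disk_automorphisms" "\<And>z. norm z < 1 \<Longrightarrow> A (A' z) = z" 
    using disk_automorphism_inverse AC(1) by metis
  obtain D where D: "D \<in> disk_automorphisms" "\<And>z. norm z < 1 \<Longrightarrow> D z = A' (C z)"
    using disk_automorphism_compose A'(1) AC(2) by metis
  obtain \<nu> w where w: "norm \<nu> = 1" "norm w < 1" "D = (\<lambda>z. \<nu> * blaschke_factor w z)"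
    using D(1) by (auto simp: disk_automorphisms_iff)
  show ?thesis
  proof (rule that[OF w(1,2) s(1)])
    fix \<kappa> F assume k: "norm \<kappa> = 1" 
      and F: "\<And>z. norm z < 1 \<Longrightarrow> F z = \<nu> * \<kappa>\<^sup>2 * blaschke_factor (w * cnj (\<kappa> ^ 3)) (odd_cubic (s * \<kappa>\<^sup>2) z)"
    have kk: "cnj \<kappa> * \<kappa> = 1" by (rule norm_1_cnj[OF k])
    have "(\<lambda>z. cnj \<kappa> * z) \<in> disk_automorphisms" using k by (intro rotation_disk_automorphism) simp
    then obtain M where M: "M \<in> disk_automorphisms" "\<And>z. norm z < 1 \<Longrightarrow> M z = cnj \<kappa> * A' z"
      using disk_automorphism_compose A'(1) by metis
    have F': "F z = cnj \<kappa> * D (odd_cubic s (\<kappa> * z))" if "norm z < 1" for z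
    proof -
      have "D (odd_cubic s (\<kappa> * z)) = \<nu> * (\<kappa> ^ 3 * blaschke_factor (w * cnj (\<kappa> ^ 3)) (odd_cubic (s * \<kappa>\<^sup>2) z))"
        unfolding w(3) odd_cubic_rotate[OF k] by (subst blaschke_factor_rotate) (simp_all add: k norm_power)
      then have "cnj \<kappa> * D (odd_cubic s (\<kappa> * z)) = \<nu> * ((cnj \<kappa> * \<kappa>) * \<kappa>\<^sup>2) * blaschke_factor (w * cnj (\<kappa> ^ 3)) (odd_cubic (s * \<kappa>\<^sup>2) z)"
        by (simp add: power2_eq_square power3_eq_cube)
      then show ?thesis unfolding kk F[OF that] by simp
    qed
    have "F (M z) = M (B z)" if z: "norm z < 1" for z
    proof -
      have Az: "norm (A' z) < 1" by (rule disk_automorphism_norm_less_1[OF A'(1) z])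
      have Bz: "norm (B z) < 1" by (rule cubic_blaschke_norm_less_1[OF assms z])
      have "F (M z) = cnj \<kappa> * D (odd_cubic s (\<kappa> * M z))" using F' disk_automorphism_norm_less_1[OF M(1) z] .
      also have "\<kappa> * M z = (cnj \<kappa> * \<kappa>) * A' z" using M(2)[OF z] by simp
      also have "\<dots> = A' z" by (simp add: kk)
      also have "D (odd_cubic s (A' z)) = A' (C (odd_cubic s (A' z)))" by (rule D(2)[OF odd_cubic_norm_less_1[OF s(1) Az]])
      also have "C (odd_cubic s (A' z)) = B z" using AC(3)[OF Az] A'(2)[OF z] by simp
      finally show ?thesis using M(2)[OF Bz] by simp
    qed
    then show "disk_conjugate B F" unfolding disk_conjugate_iff using M(1) by blast
  qed
qed

text \<open>
  The rotation is spent on making \<open>s\<close> real and nonnegative, and the unimodular factor remains.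
\<close>

lemma cubic_blaschke_conjugate_form_a:
  assumes "cubic_blaschke_product B"
  shows "\<exists>\<mu> s0 r0. norm \<mu> = 1 \<and> s0 \<in> {0..<1} \<and> r0 \<in> \<bbbD> \<and> disk_conjugate B (form_a \<mu> s0 r0)"
proof -
  obtain \<nu> w s where *: "norm \<nu> = 1" "norm w < 1" "norm s < 1"
    "\<And>\<kappa> F. \<lbrakk>norm \<kappa> = 1; \<And>z. norm z < 1 \<Longrightarrow> F z = \<nu> * \<kappa>\<^sup>2 * blaschke_factor (w * cnj (\<kappa> ^ 3)) (odd_cubic (s * \<kappa>\<^sup>2) z)\<rbrakk>
      \<Longrightarrow> disk_conjugate B F" using cubic_blaschke_conjugate_family[OF assms] by metis
  define \<kappa> where "\<kappa> = (if s = 0 then 1 else csqrt (of_real (norm s) / s))"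
  have k: "norm \<kappa> = 1" "s * \<kappa>\<^sup>2 = of_real (norm s)" by (auto simp: \<kappa>_def norm_csqrt norm_divide)
  define s0 where "s0 = sqrt (norm s)"
  have s0: "s0\<^sup>2 = norm s" "0 \<le> s0" "s0 < 1" using *(3) by (auto simp: s0_def)
  define r0 where "r0 = - (w * cnj (\<kappa> ^ 3))"
  have "disk_conjugate B (form_a (\<nu> * \<kappa>\<^sup>2) s0 r0)"
    by (rule *(4)[OF k(1)]) (use s0 in \<open>simp add: form_a_eq k r0_def del: of_real_power\<close>)
  moreover have "norm (\<nu> * \<kappa>\<^sup>2) = 1" "r0 \<in> \<bbbD>" using * k by (simp_all add: r0_def norm_mult norm_power)
  ultimately show ?thesis using s0 by (intro exI[of _ "\<nu> * \<kappa>\<^sup>2"] exI[of _ s0] exI[of _ r0]) simp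
qed

text \<open>
  The rotation is spent on removing the unimodular factor, and \<open>s\<close> remains complex.
\<close>

lemma cubic_blaschke_conjugate_form_b:
  assumes "cubic_blaschke_product B"
  shows "\<exists>r\<in>\<bbbD>. \<exists>s\<in>\<bbbD>. disk_conjugate B (form_b r s)"
proof -
  obtain \<nu> w s where *: "norm \<nu> = 1" "norm w < 1" "norm s < 1"
    "\<And>\<kappa> F. \<lbrakk>norm \<kappa> = 1; \<And>z. norm z < 1 \<Longrightarrow> F z = \<nu> * \<kappa>\<^sup>2 * blaschke_factor (w * cnj (\<kappa> ^ 3)) (odd_cubic (s * \<kappa>\<^sup>2) z)\<rbrakk>
      \<Longrightarrow> disk_conjugate B F" using cubic_blaschke_conjugate_family[OF assms] by metis
  define \<kappa> where "\<kappa> = csqrt (cnj \<nu>)"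
  have k: "norm \<kappa> = 1" "\<nu> * \<kappa>\<^sup>2 = 1" using *(1) norm_1_cnj[of \<nu>] by (auto simp: \<kappa>_def norm_csqrt mult.commute)
  define r where "r = - (w * cnj (\<kappa> ^ 3))"
  have s: "norm (s * \<kappa>\<^sup>2) < 1" using * k by (simp add: norm_mult norm_power)
  have "disk_conjugate B (form_b r (s * \<kappa>\<^sup>2))"
    by (rule *(4)[OF k(1)]) (simp add: form_b_eq[OF s] k r_def)
  moreover have "norm r < 1" using * k by (simp add: r_def norm_mult norm_power)
  ultimately show ?thesis using s by (intro bexI[of _ r] bexI[of _ "s * \<kappa>\<^sup>2"]) simp_all
qed

section \<open>Uniqueness of the parameters\<close>

lemma odd_cubic_deriv:
  assumes "norm s < 1" "norm z < 1"
  shows "(odd_cubic s has_field_derivative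
    - (s * z ^ 4 - (3 - s * cnj s) * z\<^sup>2 + cnj s) / (1 - s * z\<^sup>2)\<^sup>2) (at z)"
proof -
  have d: "1 - s * z\<^sup>2 \<noteq> 0" by (rule one_minus_mult_square_nonzero[OF assms])
  have "((\<lambda>z. z ^ 3 - cnj s * z) has_field_derivative 3 * z\<^sup>2 - cnj s) (at z)"
    by (auto intro!: derivative_eq_intros)
  moreover have "((\<lambda>z. 1 - s * z\<^sup>2) has_field_derivative - (2 * s * z)) (at z)"
    by (auto intro!: derivative_eq_intros)
  ultimately have "((\<lambda>z. (z ^ 3 - cnj s * z) / (1 - s * z\<^sup>2)) has_field_derivative
      ((3 * z\<^sup>2 - cnj s) * (1 - s * z\<^sup>2) - (z ^ 3 - cnj s * z) * - (2 * s * z)) / ((1 - s * z\<^sup>2) * (1 - s * z\<^sup>2))) (at z)"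
    using d by (rule DERIV_divide)
  also have "(3 * z\<^sup>2 - cnj s) * (1 - s * z\<^sup>2) - (z ^ 3 - cnj s * z) * - (2 * s * z) =
      - (s * z ^ 4 - (3 - s * cnj s) * z\<^sup>2 + cnj s)"
    by (simp add: algebra_simps power2_eq_square power3_eq_cube power4_eq_xxxx)
  finally show ?thesis unfolding odd_cubic_def[abs_def] power2_eq_square[of "1 - s * z\<^sup>2"] .
qed

lemma odd_cubic_critical_iff:
  assumes "norm s < 1" "norm z < 1"
  shows "(odd_cubic s has_field_derivative 0) (at z) \<longleftrightarrow> s * z ^ 4 - (3 - s * cnj s) * z\<^sup>2 + cnj s = 0"
proof
  assume "(odd_cubic s has_field_derivative 0) (at z)"
  then have "- (s * z ^ 4 - (3 - s * cnj s) * z\<^sup>2 + cnj s) / (1 - s * z\<^sup>2)\<^sup>2 = 0"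
    using DERIV_unique odd_cubic_deriv[OF assms] by blast
  moreover have "(1 - s * z\<^sup>2)\<^sup>2 \<noteq> 0" using one_minus_mult_square_nonzero[OF assms] by simp
  ultimately show "s * z ^ 4 - (3 - s * cnj s) * z\<^sup>2 + cnj s = 0"
    by (simp only: divide_eq_0_iff neg_equal_0_iff_equal simp_thms)
next
  assume "s * z ^ 4 - (3 - s * cnj s) * z\<^sup>2 + cnj s = 0"
  then show "(odd_cubic s has_field_derivative 0) (at z)" using odd_cubic_deriv[OF assms] by simp
qed

lemma odd_cubic_critical_uminus:
  assumes "norm s < 1" "norm z < 1" "(odd_cubic s has_field_derivative 0) (at z)"
  shows "(odd_cubic s has_field_derivative 0) (at (- z))"
  using assms odd_cubic_critical_iff[of s "- z"] odd_cubic_critical_iff[of s z] by simp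

text \<open>
  If two critical points have different squares \<open>x\<close> and \<open>y\<close>, subtracting their equations gives
  \<open>s (x + y) + |s|\<^sup>2 = 3\<close>, which is impossible since the left-hand side has modulus below \<open>3\<close>.
\<close>

lemma odd_cubic_critical_unique:
  assumes s: "norm s < 1" and z: "norm z < 1" "(odd_cubic s has_field_derivative 0) (at z)"
    and w: "norm w < 1" "(odd_cubic s has_field_derivative 0) (at w)"
  shows "w = z \<or> w = - z"
proof (rule ccontr)
  assume "\<not> (w = z \<or> w = - z)"
  then have ne: "z\<^sup>2 - w\<^sup>2 \<noteq> 0" by (auto simp: power2_eq_iff)
  have "s * z ^ 4 - (3 - s * cnj s) * z\<^sup>2 + cnj s = 0" "s * w ^ 4 - (3 - s * cnj s) * w\<^sup>2 + cnj s = 0"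
    using assms odd_cubic_critical_iff by blast+
  then have "(s * z ^ 4 - (3 - s * cnj s) * z\<^sup>2 + cnj s) - (s * w ^ 4 - (3 - s * cnj s) * w\<^sup>2 + cnj s) = 0" by simp
  then have "(z\<^sup>2 - w\<^sup>2) * (s * (z\<^sup>2 + w\<^sup>2) + s * cnj s - 3) = 0"
    by (simp add: algebra_simps power2_eq_square power4_eq_xxxx)
  then have "s * (z\<^sup>2 + w\<^sup>2) + s * cnj s = 3" using ne by simp
  then have "norm (s * (z\<^sup>2 + w\<^sup>2) + s * cnj s) = 3" by simp
  moreover have "norm (s * (z\<^sup>2 + w\<^sup>2) + s * cnj s) \<le> norm s * norm (z\<^sup>2 + w\<^sup>2) + norm s * norm s"
    by (metis complex_mod_cnj norm_mult norm_triangle_ineq)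
  moreover have "norm (z\<^sup>2 + w\<^sup>2) \<le> 1 + 1"
    using z w by (intro norm_triangle_mono) (simp_all add: norm_power power_le_one)
  then have "norm s * norm (z\<^sup>2 + w\<^sup>2) \<le> 1 * 2" using s by (intro mult_mono) auto
  moreover have "norm s * norm s < 1" using s mult_strict_mono'[of "norm s" 1 "norm s" 1] by simp
  ultimately show False by linarith
qed

text \<open>
  Disk automorphisms preserve hyperbolic midpoints, and \<open>0\<close> is the midpoint both of \<open>c\<close>, \<open>- c\<close> and of
  their images.
\<close>

lemma disk_automorphism_preserving_opposites:
  assumes "A \<in> disk_automorphisms" "norm c < 1" "c \<noteq> 0" "A (- c) = - A c"
  shows "A 0 = 0"
proof -
  obtain \<mu> w where A: "norm \<mu> = 1" "norm w < 1" "A = (\<lambda>z. \<mu> * blaschke_factor w z)"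
    using assms by (auto simp: disk_automorphisms_iff)
  have d: "1 - cnj w * c \<noteq> 0" "1 - cnj w * (- c) \<noteq> 0" 
    using one_minus_cnj_mult_nonzero[OF A(2), of c] one_minus_cnj_mult_nonzero[OF A(2), of "- c"] assms(2)
    by simp_all
  have "\<mu> \<noteq> 0" using A by auto
  moreover have "\<mu> * blaschke_factor w (- c) = \<mu> * (- blaschke_factor w c)"
    using assms(4) by (simp add: A(3))
  ultimately have "blaschke_factor w (- c) = - blaschke_factor w c" by (rule mult_left_cancel[THEN iffD1])
  then have "(- c - w) / (1 - cnj w * (- c)) = (w - c) / (1 - cnj w * c)"
    by (simp only: blaschke_factor_def minus_divide_left minus_diff_eq)
  then have "(- c - w) * (1 - cnj w * c) = (w - c) * (1 - cnj w * (- c))"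
    by (rule iffD1[OF frac_eq_eq[OF d(2,1)]])
  then have "w = cnj w * c\<^sup>2" by (simp add: algebra_simps power2_eq_square)
  then have "norm w = norm w * norm c ^ 2" by (metis complex_mod_cnj norm_mult norm_power)
  moreover have "norm c ^ 2 < 1" using assms by (simp add: power_less_one_iff)
  ultimately have "w = 0" by auto
  then show ?thesis by (simp add: A(3))
qed

text \<open>
  The automorphism \<open>A\<close> carries the critical points \<open>\<plusminus> c\<close> of one odd map to the critical points of the other,
  hence preserves their midpoint \<open>0\<close>.  When both critical points coincide at \<open>0\<close>, this needs the
  inverse of \<open>A\<close> to see that the image is also a single point.
\<close>

lemma odd_cubic_equivalence_fixes_0:
  assumes A: "A \<in> disk_automorphisms" and C: "C \<in> disk_automorphisms" and s: "norm s < 1" and s': "norm s' < 1"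
    and eq: "\<And>z. norm z < 1 \<Longrightarrow> odd_cubic s' (A z) = C (odd_cubic s z)"
  shows "A 0 = 0"
proof -
  obtain A' where A': "A' \<in> disk_automorphisms" "\<And>z. norm z < 1 \<Longrightarrow> A (A' z) = z" "\<And>z. norm z < 1 \<Longrightarrow> A' (A z) = z"
    using disk_automorphism_inverse A by metis
  obtain C' where C': "C' \<in> disk_automorphisms" "\<And>z. norm z < 1 \<Longrightarrow> C' (C z) = z"
    using disk_automorphism_inverse C by metis
  note A_disk = disk_automorphism_norm_less_1[OF A] and A'_disk = disk_automorphism_norm_less_1[OF A'(1)]
  have forward: "(odd_cubic s' has_field_derivative 0) (at (A z))"
    if z: "norm z < 1" "(odd_cubic s has_field_derivative 0) (at z)" for z
  proof (rule critical_point_transport[OF A'(1) C A_disk[OF z(1)]])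
    show "(odd_cubic s has_field_derivative 0) (at (A' (A z)))" using z A'(3) by simp
    show "norm (odd_cubic s (A' (A z))) < 1" using z A'(3) odd_cubic_norm_less_1 s by simp
    show "odd_cubic s' x = C (odd_cubic s (A' x))" if "norm x < 1" for x
      using eq[OF A'_disk[OF that]] A'(2)[OF that] by simp
  qed
  have backward: "(odd_cubic s has_field_derivative 0) (at (A' z))"
    if z: "norm z < 1" "(odd_cubic s' has_field_derivative 0) (at z)" for z
  proof (rule critical_point_transport[OF A C'(1) A'_disk[OF z(1)]])
    show "(odd_cubic s' has_field_derivative 0) (at (A (A' z)))" using z A'(2) by simp
    show "norm (odd_cubic s' (A (A' z))) < 1" using z A'(2) odd_cubic_norm_less_1 s' by simp
    show "odd_cubic s x = C' (odd_cubic s' (A x))" if "norm x < 1" for x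
      using eq[OF that] C'(2)[OF odd_cubic_norm_less_1[OF s that]] by simp
  qed
  obtain c where c: "norm c < 1" "(odd_cubic s has_field_derivative 0) (at c)"
    using cubic_blaschke_critical_point cubic_blaschke_odd_cubic s by blast
  show ?thesis
  proof (cases "c = 0")
    case True
    have "(odd_cubic s has_field_derivative 0) (at (A' (- A 0)))"
      using c True by (intro backward odd_cubic_critical_uminus forward s') (auto simp: A_disk)
    then have "A' (- A 0) = 0"
      using odd_cubic_critical_unique[OF s c, of "A' (- A 0)"] True by (simp add: A_disk A'_disk)
    then have "A 0 = - A 0" using A'(2)[of "- A 0"] by (simp add: A_disk)
    then show ?thesis by simp
  next
    case False
    have "(odd_cubic s' has_field_derivative 0) (at (A c))" "(odd_cubic s' has_field_derivative 0) (at (A (- c)))"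
      using c by (auto intro!: forward odd_cubic_critical_uminus s)
    then have "A (- c) = A c \<or> A (- c) = - A c"
      using odd_cubic_critical_unique[OF s', of "A c" "A (- c)"] A_disk c(1) by simp
    moreover have "A (- c) \<noteq> A c"
    proof
      assume "A (- c) = A c"
      then have "- c = c" using A'(3)[of c] A'(3)[of "- c"] c(1) by simp
      then show False using False by simp
    qed
    ultimately show ?thesis
      using disk_automorphism_preserving_opposites[OF A c(1) False] by blast
  qed
qed

text \<open>
  The derivatives at \<open>0\<close> give \<open>s' = s\<close>.  Cross-multiplying what remains and comparing at one nonzero point
  leaves \<open>(1 - \<kappa>\<^sup>2) (1 - |s|\<^sup>2) = 0\<close>.
\<close>

lemma odd_cubic_rotation_rigid:
  assumes k: "norm \<kappa> = 1" and s: "norm s < 1" and s': "norm s' < 1"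
    and eq: "\<And>z. norm z < 1 \<Longrightarrow> odd_cubic s z = \<kappa>\<^sup>2 * odd_cubic (s' * \<kappa>\<^sup>2) z"
  shows "s' = s" "\<kappa> = 1 \<or> \<kappa> = - 1"
proof -
  have kk: "cnj \<kappa> * \<kappa> = 1" by (rule norm_1_cnj[OF k])
  have t: "norm (s' * \<kappa>\<^sup>2) < 1" using s' k by (simp add: norm_mult norm_power)
  have "(odd_cubic s has_field_derivative - cnj s) (at 0)" using odd_cubic_deriv[OF s, of 0] by simp
  moreover have "((\<lambda>z. \<kappa>\<^sup>2 * odd_cubic (s' * \<kappa>\<^sup>2) z) has_field_derivative \<kappa>\<^sup>2 * - cnj (s' * \<kappa>\<^sup>2)) (at 0)"
    using DERIV_cmult[OF odd_cubic_deriv[OF t, of 0], of "\<kappa>\<^sup>2"] by simp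
  then have "(odd_cubic s has_field_derivative \<kappa>\<^sup>2 * - cnj (s' * \<kappa>\<^sup>2)) (at 0)"
    by (rule has_field_derivative_transform_within_open[of _ _ _ \<bbbD>]) (use eq in auto)
  ultimately have "- cnj s = \<kappa>\<^sup>2 * - cnj (s' * \<kappa>\<^sup>2)" using DERIV_unique by blast
  also have "\<dots> = - cnj s' * (cnj \<kappa> * \<kappa>) * (cnj \<kappa> * \<kappa>)" by (simp add: power2_eq_square)
  also have "\<dots> = - cnj s'" by (simp add: kk)
  finally show ss: "s' = s" by simp
  define q where "q = \<kappa>\<^sup>2"
  have qq: "cnj q * q = 1" using norm_1_cnj[of q] k by (simp add: q_def norm_power)
  have t: "norm (s * q) < 1" using s k by (simp add: q_def norm_mult norm_power)
  \<comment> \<open>After cross-multiplying and cancelling a factor \<open>z\<close>, only the coefficient of \<open>z\<^sup>2\<close> differs, so any nonzero point, here \<open>1/2\<close>, will do.\<close>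
  have half: "norm (1 / 2 :: complex) < 1" by simp
  have d: "1 - s * (1 / 2)\<^sup>2 \<noteq> 0" "1 - s * q * (1 / 2)\<^sup>2 \<noteq> 0"
    by (rule one_minus_mult_square_nonzero[OF s half] one_minus_mult_square_nonzero[OF t half])+
  have "odd_cubic s (1 / 2) = q * odd_cubic (s * q) (1 / 2)" using eq[OF half] by (simp add: ss q_def)
  then have "((1 / 2) ^ 3 - cnj s * (1 / 2)) / (1 - s * (1 / 2)\<^sup>2) = (q * (1 / 2) ^ 3 - cnj s * (cnj q * q) * (1 / 2)) / (1 - s * q * (1 / 2)\<^sup>2)"
    by (simp add: odd_cubic_def algebra_simps)
  then have "((1 / 2) ^ 3 - cnj s * (1 / 2)) * (1 - s * q * (1 / 2)\<^sup>2) = (q * (1 / 2) ^ 3 - cnj s * (1 / 2)) * (1 - s * (1 / 2)\<^sup>2)"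
    unfolding qq mult_1_right by (rule iffD1[OF frac_eq_eq[OF d]])
  then have "((1 / 2) ^ 3 - cnj s * (1 / 2)) * (1 - s * q * (1 / 2)\<^sup>2) - (q * (1 / 2) ^ 3 - cnj s * (1 / 2)) * (1 - s * (1 / 2)\<^sup>2) = 0"
    by simp
  also have "((1 / 2) ^ 3 - cnj s * (1 / 2)) * (1 - s * q * (1 / 2)\<^sup>2) - (q * (1 / 2) ^ 3 - cnj s * (1 / 2)) * (1 - s * (1 / 2)\<^sup>2)
      = (1 - q) * (1 - s * cnj s) / 8"
    by (simp add: power2_eq_square power3_eq_cube field_simps)
  finally have "(1 - q) * (1 - s * cnj s) = 0" by simp
  moreover have "1 - s * cnj s \<noteq> 0" using one_minus_cnj_mult_nonzero[of s s] s by (simp add: mult.commute)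
  ultimately have "\<kappa>\<^sup>2 = 1" by (simp add: q_def)
  then show "\<kappa> = 1 \<or> \<kappa> = - 1" by (simp add: power2_eq_1_iff)
qed

text \<open>
  Removing the outer automorphisms shows that the conjugating map intertwines two odd maps, so it fixes \<open>0\<close> and is a
  rotation by some \<open>\<kappa>\<close>.  The values at \<open>0\<close> give \<open>r' = \<kappa> r\<close>, and rigidity gives \<open>\<kappa> = \<plusminus> 1\<close>.
\<close>

lemma form_b_conjugate_unique:
  assumes M: "M \<in> disk_automorphisms" and r: "norm r < 1" and s: "norm s < 1" and r': "norm r' < 1" and s': "norm s' < 1"
    and conj: "\<And>z. norm z < 1 \<Longrightarrow> form_b r' s' (M z) = M (form_b r s z)"
  shows "s' = s \<and> (r' = r \<or> r' = - r)"
proof -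
  note M_disk = disk_automorphism_norm_less_1[OF M]
  have T: "blaschke_factor (- r) \<in> disk_automorphisms" "blaschke_factor (- r') \<in> disk_automorphisms"
    using r r' by (auto intro: blaschke_factor_disk_automorphism)
  have conj': "blaschke_factor (- r') (odd_cubic s' (M z)) = M (blaschke_factor (- r) (odd_cubic s z))" if "norm z < 1" for z
    using conj[OF that] that M_disk[OF that] by (simp add: form_b_eq s s')
  obtain T' where T': "T' \<in> disk_automorphisms" "\<And>z. norm z < 1 \<Longrightarrow> T' (blaschke_factor (- r') z) = z"
    using disk_automorphism_inverse T(2) by metis
  obtain C1 where C1: "C1 \<in> disk_automorphisms" "\<And>z. norm z < 1 \<Longrightarrow> C1 z = M (blaschke_factor (- r) z)"
    using disk_automorphism_compose M T(1) by metis
  obtain C where C: "C \<in> disk_automorphisms" "\<And>z. norm z < 1 \<Longrightarrow> C z = T' (C1 z)"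
    using disk_automorphism_compose T'(1) C1(1) by metis
  have "odd_cubic s' (M z) = C (odd_cubic s z)" if z: "norm z < 1" for z
  proof -
    have "norm (odd_cubic s z) < 1" "norm (odd_cubic s' (M z)) < 1"
      using odd_cubic_norm_less_1 s s' z M_disk by blast+
    then show ?thesis using conj'[OF z] T'(2) C C1 by metis
  qed
  then have "M 0 = 0" using odd_cubic_equivalence_fixes_0 M C(1) s s' by blast
  moreover obtain \<kappa> w where M_eq: "norm \<kappa> = 1" "norm w < 1" "M = (\<lambda>z. \<kappa> * blaschke_factor w z)"
    using M by (auto simp: disk_automorphisms_iff)
  ultimately have Mz: "M z = \<kappa> * z" for z using M_eq by auto
  have kk: "cnj \<kappa> * \<kappa> = 1" by (rule norm_1_cnj[OF M_eq(1)])
  have k0: "\<kappa> \<noteq> 0" using M_eq by auto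
  have rr: "r' = \<kappa> * r" using conj[of 0] by (simp add: Mz form_b_def)
  have "odd_cubic s z = \<kappa>\<^sup>2 * odd_cubic (s' * \<kappa>\<^sup>2) z" if z: "norm z < 1" for z
  proof -
    define u where "u = \<kappa>\<^sup>2 * odd_cubic (s' * \<kappa>\<^sup>2) z"
    have t: "norm (s' * \<kappa>\<^sup>2) < 1" using s' M_eq by (simp add: norm_mult norm_power)
    have u: "norm u < 1" using odd_cubic_norm_less_1[OF t z] M_eq by (simp add: u_def norm_mult norm_power)
    have o: "odd_cubic s' (\<kappa> * z) = \<kappa> * u" 
      unfolding odd_cubic_rotate[OF M_eq(1)] u_def by (simp add: power2_eq_square power3_eq_cube)
    have "- r' * cnj \<kappa> = - r * (cnj \<kappa> * \<kappa>)" by (simp add: rr)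
    then have "- r' * cnj \<kappa> = - r" by (simp only: kk mult_1_right)
    then have "\<kappa> * blaschke_factor (- r) u = \<kappa> * blaschke_factor (- r) (odd_cubic s z)"
      using conj'[OF z] unfolding Mz o blaschke_factor_rotate[OF M_eq(1)] by simp
    then have "blaschke_factor (- r) u = blaschke_factor (- r) (odd_cubic s z)" using k0 by simp
    then have "u = odd_cubic s z"
      using disk_automorphism_inverse[OF T(1)] u odd_cubic_norm_less_1[OF s z] by metis
    then show ?thesis by (simp add: u_def)
  qed
  then have "s' = s" "\<kappa> = 1 \<or> \<kappa> = - 1" using odd_cubic_rotation_rigid M_eq(1) s s' by blast+
  then show ?thesis using rr by auto
qed

text \<open>
  Conjugation by \<open>z \<mapsto> - z\<close> is the identification of \<open>(r, s)\<close> with \<open>(- r, s)\<close>.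
\<close>

lemma form_b_uminus: "form_b (- r) s (- z) = - form_b r s z"
proof -
  have "form_b (- r) s (- z) = - (z ^ 3 - s * r * z\<^sup>2 - cnj s * z + r) / (cnj r * z ^ 3 - s * z\<^sup>2 - cnj (s * r) * z + 1)"
    by (simp add: form_b_def)
  then show ?thesis by (simp only: form_b_def minus_divide_left)
qed

lemma disk_conjugate_form_b_uminus:
  assumes "disk_conjugate B (form_b r s)"
  shows "disk_conjugate B (form_b (- r) s)"
proof -
  obtain M where M: "M \<in> disk_automorphisms" "\<And>z. norm z < 1 \<Longrightarrow> form_b r s (M z) = M (B z)"
    using assms unfolding disk_conjugate_iff by blast
  obtain \<mu> w where w: "norm \<mu> = 1" "norm w < 1" "M = (\<lambda>z. \<mu> * blaschke_factor w z)"
    using M(1) by (auto simp: disk_automorphisms_iff)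
  have "(\<lambda>z. - M z) \<in> disk_automorphisms"
    unfolding disk_automorphisms_iff by (rule exI[of _ "- \<mu>"], rule exI[of _ w]) (simp add: w)
  moreover have "form_b (- r) s (- M z) = - M (B z)" if "norm z < 1" for z
    using M(2)[OF that] by (simp add: form_b_uminus)
  ultimately show ?thesis unfolding disk_conjugate_iff by (intro bexI[of _ "\<lambda>z. - M z"]) auto
qed

lemma disk_conjugate_both:
  assumes "cubic_blaschke_product B" "disk_conjugate B F" "disk_conjugate B G"
  obtains M where "M \<in> disk_automorphisms" "\<And>z. norm z < 1 \<Longrightarrow> G (M z) = M (F z)"
proof -
  obtain M1 where M1: "M1 \<in> disk_automorphisms" "\<And>z. norm z < 1 \<Longrightarrow> F (M1 z) = M1 (B z)"
    using assms(2) unfolding disk_conjugate_iff by blast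
  obtain M2 where M2: "M2 \<in> disk_automorphisms" "\<And>z. norm z < 1 \<Longrightarrow> G (M2 z) = M2 (B z)"
    using assms(3) unfolding disk_conjugate_iff by blast
  obtain N where N: "N \<in> disk_automorphisms" "\<And>z. norm z < 1 \<Longrightarrow> M1 (N z) = z" "\<And>z. norm z < 1 \<Longrightarrow> N (M1 z) = z"
    using disk_automorphism_inverse M1(1) by metis
  obtain M where M: "M \<in> disk_automorphisms" "\<And>z. norm z < 1 \<Longrightarrow> M z = M2 (N z)"
    using disk_automorphism_compose M2(1) N(1) by metis
  have "G (M z) = M (F z)" if z: "norm z < 1" for z
  proof -
    have Nz: "norm (N z) < 1" by (rule disk_automorphism_norm_less_1[OF N(1) z])
    have B: "norm (B (N z)) < 1" by (rule cubic_blaschke_norm_less_1[OF assms(1) Nz])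
    have F: "F z = M1 (B (N z))" using M1(2)[OF Nz] N(2)[OF z] by simp
    then have "norm (F z) < 1" using disk_automorphism_norm_less_1[OF M1(1) B] by simp
    then have "M (F z) = M2 (B (N z))" using M(2) F N(3)[OF B] by simp
    then show ?thesis using M(2)[OF z] M2(2)[OF Nz] by simp
  qed
  then show ?thesis using that M(1) by blast
qed

theorem proposition1p1:
  fixes B :: "complex \<Rightarrow> complex"
  assumes "cubic_blaschke_product B"
  shows
    "(\<exists>\<mu> s0 r0. norm \<mu> = 1 \<and> s0 \<in> {0..<1} \<and> r0 \<in> \<bbbD> \<and>
        cubic_blaschke_product (form_a \<mu> s0 r0) \<and> disk_conjugate B (form_a \<mu> s0 r0)) \<and>
     (\<exists>r\<in>\<bbbD>. \<exists>s\<in>\<bbbD>. cubic_blaschke_product (form_b r s) \<and> disk_conjugate B (form_b r s)) \<and>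
     (\<forall>r\<in>\<bbbD>. \<forall>s\<in>\<bbbD>. \<forall>r'\<in>\<bbbD>. \<forall>s'\<in>\<bbbD>.
        disk_conjugate B (form_b r s) \<longrightarrow>
          (disk_conjugate B (form_b r' s') \<longleftrightarrow> s' = s \<and> (r' = r \<or> r' = - r)))"
proof (intro conjI ballI impI)
  show "\<exists>\<mu> s0 r0. norm \<mu> = 1 \<and> s0 \<in> {0..<1} \<and> r0 \<in> \<bbbD> \<and>
      cubic_blaschke_product (form_a \<mu> s0 r0) \<and> disk_conjugate B (form_a \<mu> s0 r0)"
    using cubic_blaschke_conjugate_form_a[OF assms] disk_conjugate_cubic_blaschke[OF _ assms] by blast
  show "\<exists>r\<in>\<bbbD>. \<exists>s\<in>\<bbbD>. cubic_blaschke_product (form_b r s) \<and> disk_conjugate B (form_b r s)"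
    using cubic_blaschke_conjugate_form_b[OF assms] disk_conjugate_cubic_blaschke[OF _ assms] by blast
  fix r s r' s' assume rs: "r \<in> \<bbbD>" "s \<in> \<bbbD>" "r' \<in> \<bbbD>" "s' \<in> \<bbbD>" and B: "disk_conjugate B (form_b r s)"
  show "disk_conjugate B (form_b r' s') \<longleftrightarrow> s' = s \<and> (r' = r \<or> r' = - r)"
  proof
    assume "disk_conjugate B (form_b r' s')"
    then obtain M where "M \<in> disk_automorphisms" "\<And>z. norm z < 1 \<Longrightarrow> form_b r' s' (M z) = M (form_b r s z)"
      using disk_conjugate_both[OF assms B] by blast
    then show "s' = s \<and> (r' = r \<or> r' = - r)" using form_b_conjugate_unique rs by simp
  next
    assume "s' = s \<and> (r' = r \<or> r' = - r)"
    then show "disk_conjugate B (form_b r' s')" using B disk_conjugate_form_b_uminus by blast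
  qed
qed

end
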